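(* Let $G$ be a ribbon graph. Then 1. $\Omega\big(G;0,\sqrt{y/x},1,0,\sqrt{xy}\big)=x^{\kappa(G)}\big(\sqrt{y/x}\big)^{|V(G)|}\,T(G;x+1,y+1)$, when $G$ is plane; 2. $\Omega\big(G;0,\sqrt{y/x},1,0,\sqrt{xy}\big)=x^{\kappa(G)}\big(\sqrt{y/x}\big)^{|V(G)|}\,R(G;x+1,y,1/\sqrt{xy})$; 3. $\Omega(G;0,1,0,-1,\lambda)=P(G;\lambda)$; 4. $\Omega(G;0,\alpha,\beta,\gamma,t)=Q(G;(\alpha,\beta,\gamma),t)$. Here $T$ is the Tutte polynomial, $R$ the Bollobás–Riordan polynomial, $P$ the (topological) Penrose polynomial, and $Q$ the topological transition polynomial.
   Context: **Ribbon graphs.** A ribbon graph $G=(V(G),E(G))$ is a surface with boundary, represented as the union of two sets of discs, a set $V(G)$ of vertices and a set $E(G)$ of edges, such that: (1) the vertices and edges intersect in disjoint line segments; (2) each such line segment lies on the boundary of precisely one vertex and precisely one edge; (3) every edge contains exactly two such line segments. Equivalence is homeomorphism (orientation preserving when orientable) mapping vertices to vertices and edges to edges. A ribbon graph is plane if it has genus zero, i.e. capping off its boundary components with discs yields spheres. Let $e\in E(G)$. *Deletion:* $G\setminus e$ is obtained by removing the edge $e$. *Contraction:* if $u,v$ are the (not necessarily distinct) vertices incident with $e$, consider the boundary component(s) of $e\cup\{u,v\}$ as curves on $G$; for each curve attach a disc (a new vertex) by identifying its boundary with the curve, and then delete $e,u,v$; the result is $G/e$. *Partial Petrial:* $G^{\tau(e)}$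 is obtained by detaching one end of $e$ from its incident vertex $v$, creating arcs $[a,b]$ on $v$ and $[a',b']$ on $e$ (so that $G$ is recovered by identifying $[a,b]$ with $[a',b']$), and reattaching by identifying $[a,b]$ with $[b',a']$ (giving $e$ a half-twist). For $A\subseteq E(G)$, $G^{\tau(A)}$ is the result of doing this for every edge of $A$. *Penrose-contraction:* $G\rightthreetimes e:=G^{\tau(e)}/e$. **Edge-point ribbon graphs.** An edge-point ribbon graph is an object obtained from a ribbon graph $(V,E)$ by contracting each edge (disc) in some (possibly empty) subset of $E$ to a point; the points so created are singular points and the images of the other edges are its edges. Equivalently, it is an edge 2-coloured ribbon graph in which dark grey edges represent those contracted to points and light grey edges are the edges of the edge-point ribbon graph (considered up to partial Petrials of dark grey edges). Ribbon graphs are the edge-point ribbon graphs with no singular points. Deletion, contraction and Penrose-contraction are inherited by performing the ribbon graph operations on light grey edges in the 2-coloured model. $G\odot e$ is obtained by contracting $e$ to a point (recolouring $e$ dark grey). **The polynomial $\Omega$.** $\Omega(G)=\Omega(G;w,x,y,z,t)\in\mathbb{Z}[w,x,y,z,t]$ is the polynomial of edge-point ribbon graphs defined by $\Omega(G)=w\,\Omega(G\odot e)+x\,\Omega(G/e)+y\,\Omega(G\setminus e)+z\,\Omega(G\rightthreetimes e)$ for any edge $e$, and $\Omega(G)=t^{\kappa(G)}$ if $G$ is edgeless, where $\kappa(G)$ is the number of connected components. **Other polynomials (standard definitions).** For $A\subseteq E(G)$ let $\kappa(A)$ and $f(A)$ be the numbers of connected components and boundary components of the spanning ribbon subgraph $(V(G),A)$,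 $r(A)=|V(G)|-\kappa(A)$, $n(A)=|A|-r(A)$, $r(G)=r(E(G))$. - $T(G;x,y)=\sum_{A\subseteq E(G)}(x-1)^{r(G)-r(A)}(y-1)^{n(A)}$. - $R(G;x,y,z)=\sum_{A\subseteq E(G)}(x-1)^{r(G)-r(A)}y^{n(A)}z^{\kappa(A)-f(A)+n(A)}$. - $P(G;\lambda)=\sum_{A\subseteq E(G)}(-1)^{|A|}\lambda^{f(G^{\tau(A)})}$, where $f(H)$ is the number of boundary components of $H$. - $Q(G;(\alpha,\beta,\gamma),t)=\sum_s \alpha^{a(s)}\beta^{b(s)}\gamma^{c(s)}t^{\ell(s)}$. The sum is over all graph states $s$ of the canonically checkerboard coloured medial graph $G_m$ (one vertex on each edge of $G$, edges following the boundary of $G$ around the vertices of $G$, plus a free-loop, i.e. a circular edge without vertices, for each isolated vertex; faces containing vertices of $G$ are black and the others white). A graph state replaces each 4-valent vertex by two disjoint arcs joining its four half-edges in pairs in one of three ways: white (the two half-edges bordering a common white corner are joined, for each of the two white corners), black (the two half-edges bordering a common black corner are joined, for each of the two black corners), or crossing (opposite half-edges are joined). Here $a(s),b(s),c(s)$ are the numbers of white, black, crossing choices, and $\ell(s)$ is the number of resulting closed curves (including free-loops). **Square roots.** $x,y$ are indeterminates with fixed square roots $\sqrt{x},\sqrt{y}$, and $\sqrt{xy}=\sqrt{x}\sqrt{y}$, $\sqrt{y/x}=\sqrt{y}/\sqrt{x}$. *)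

theory Defs
  imports Main "HOL-Library.FuncSet"
begin

section \<open>Ribbon graphs\<close>

text \<open>
  A ribbon graph is encoded by the cell structure that its definition puts on the surface. The disc
  of the edge \<open>e\<close> is a rectangle. It meets the vertices in two opposite sides of the rectangle, its
  ends, numbered by a Boolean \<open>i\<close>; the other two sides, numbered by a Boolean \<open>s\<close>, lie on the
  boundary of the surface. The corner \<open>(e, i, s)\<close> is the point where end \<open>i\<close> meets side \<open>s\<close>.
  The corners cut the boundary circle of a vertex alternately into line segments (the ends of
  edges) and free arcs. Knowing which corners are joined by free arcs determines the surface up
  to its vertices that meet no edge, of which only the number matters. Every ribbon graph arises
  in this way, by choosing coordinates on each edge disc.
\<close>

type_synonym 'e corner = "'e \<times> bool \<times> bool"

definition corners :: "'e set \<Rightarrow> 'e corner set" where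
  "corners A = A \<times> UNIV"

text \<open>The two corners on a common end, respectively on a common side, of an edge in \<open>A\<close>.\<close>

definition ends :: "'e set \<Rightarrow> 'e corner rel" where
  "ends A = {((e, i, s), (e, i, \<not> s)) |e i s. e \<in> A}"

definition sides :: "'e set \<Rightarrow> 'e corner rel" where
  "sides A = {((e, i, s), (e, \<not> i, s)) |e i s. e \<in> A}"

record 'e ribbon =
  edges :: "'e set"
  arcs :: "'e corner rel"
  isolated :: nat

definition ribbon_graph :: "'e ribbon \<Rightarrow> bool" where
  "ribbon_graph G \<longleftrightarrow>
     finite (edges G) \<and>
     arcs G \<subseteq> corners (edges G) \<times> corners (edges G) \<and>
     sym (arcs G) \<and> irrefl (arcs G) \<and>
     (\<forall>c \<in> corners (edges G). \<exists>!d. (c, d) \<in> arcs G)"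

text \<open>
  The vertices, boundary components and connected components that contain corners, each given by
  its set of corners. A vertex that meets no edge is in addition one vertex, one boundary
  component and one connected component.
\<close>

definition vertices :: "'e ribbon \<Rightarrow> 'e corner set set" where
  "vertices G = corners (edges G) // (ends (edges G) \<union> arcs G)\<^sup>*"

definition boundaries :: "'e ribbon \<Rightarrow> 'e corner set set" where
  "boundaries G = corners (edges G) // (sides (edges G) \<union> arcs G)\<^sup>*"

definition components :: "'e ribbon \<Rightarrow> 'e corner set set" where
  "components G = corners (edges G) // (ends (edges G) \<union> sides (edges G) \<union> arcs G)\<^sup>*"

definition num_vertices :: "'e ribbon \<Rightarrow> nat" where
  "num_vertices G = card (vertices G) + isolated G"

definition num_boundaries :: "'e ribbon \<Rightarrow> nat" where
  "num_boundaries G = card (boundaries G) + isolated G"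

definition num_components :: "'e ribbon \<Rightarrow> nat" where
  "num_components G = card (components G) + isolated G"

text \<open>
  Capping off the boundary of a component with discs gives a closed connected surface with one
  cell for each vertex, edge and boundary component; it is a sphere iff its Euler characteristic
  is 2. A component without edges is a disc, which is capped off to a sphere.
\<close>

definition capped_euler_char :: "'e ribbon \<Rightarrow> 'e corner set \<Rightarrow> int" where
  "capped_euler_char G K =
     int (card {v \<in> vertices G. v \<subseteq> K})
     - int (card {e \<in> edges G. corners {e} \<subseteq> K})
     + int (card {b \<in> boundaries G. b \<subseteq> K})"

definition plane :: "'e ribbon \<Rightarrow> bool" where
  "plane G \<longleftrightarrow> (\<forall>K \<in> components G. capped_euler_char G K = 2)"


section \<open>Deletion, contraction, partial Petrials\<close>

text \<open>
  \<open>splice \<rho> B G\<close> removes the edges \<open>B\<close> and takes as new vertex boundaries the closed curves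
  that run along the old vertex boundaries but, on reaching a corner of an edge in \<open>B\<close>, continue at the
  corner to which \<open>\<rho>\<close> joins it. Curves that meet no remaining edge bound new isolated
  vertices.
\<close>

definition splice :: "'e corner rel \<Rightarrow> 'e set \<Rightarrow> 'e ribbon \<Rightarrow> 'e ribbon" where
  "splice \<rho> B G =
     \<lparr> edges = edges G - B,
       arcs = (arcs G O (\<rho> O arcs G)\<^sup>*) \<inter> (corners (edges G - B) \<times> corners (edges G - B)),
       isolated = isolated G
         + card {K \<in> corners (edges G) // (\<rho> \<union> arcs G)\<^sup>*. K \<subseteq> corners B} \<rparr>"

text \<open>
  When \<open>B\<close> is deleted, the vertex boundaries continue through the line segments where \<open>B\<close> was
  attached. When \<open>e\<close> is contracted, the new vertices are bounded by the boundary curves of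
  \<open>e\<close> together with its incident vertices, and these run along the sides of \<open>e\<close>.
\<close>

definition delete :: "'e set \<Rightarrow> 'e ribbon \<Rightarrow> 'e ribbon" where
  "delete B G = splice (ends B) B G"

definition contract :: "'e \<Rightarrow> 'e ribbon \<Rightarrow> 'e ribbon" where
  "contract e G = splice (sides {e}) {e} G"

text \<open>
  Reattaching the end \<open>True\<close> of \<open>e\<close> the other way round exchanges the two corners on that end, as
  seen from the vertex.
\<close>

definition twist :: "'e set \<Rightarrow> 'e corner \<Rightarrow> 'e corner" where
  "twist A = (\<lambda>(e, i, s). (e, i, if e \<in> A \<and> i then \<not> s else s))"

definition petrial :: "'e set \<Rightarrow> 'e ribbon \<Rightarrow> 'e ribbon" where
  "petrial A G = G\<lparr>arcs := map_prod (twist A) (twist A) ` arcs G\<rparr>"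

definition penrose_contract :: "'e \<Rightarrow> 'e ribbon \<Rightarrow> 'e ribbon" where
  "penrose_contract e G = contract e (petrial {e} G)"


section \<open>Edge-point ribbon graphs and the polynomial \<open>\<Omega>\<close>\<close>

text \<open>
  An edge-point ribbon graph is represented by an edge 2-coloured ribbon graph; the dark edges
  stand for the singular points, the light edges are its edges.
\<close>

record 'e edge_point =
  model :: "'e ribbon"
  dark :: "'e set"

definition edge_point_graph :: "'e edge_point \<Rightarrow> bool" where
  "edge_point_graph H \<longleftrightarrow> ribbon_graph (model H) \<and> dark H \<subseteq> edges (model H)"

definition light :: "'e edge_point \<Rightarrow> 'e set" where
  "light H = edges (model H) - dark H"

definition of_ribbon :: "'e ribbon \<Rightarrow> 'e edge_point" where
  "of_ribbon G = \<lparr>model = G, dark = {}\<rparr>"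

definition ep_point :: "'e \<Rightarrow> 'e edge_point \<Rightarrow> 'e edge_point" where
  "ep_point e H = H\<lparr>dark := insert e (dark H)\<rparr>"

definition ep_contract :: "'e \<Rightarrow> 'e edge_point \<Rightarrow> 'e edge_point" where
  "ep_contract e H = H\<lparr>model := contract e (model H)\<rparr>"

definition ep_delete :: "'e \<Rightarrow> 'e edge_point \<Rightarrow> 'e edge_point" where
  "ep_delete e H = H\<lparr>model := delete {e} (model H)\<rparr>"

definition ep_penrose :: "'e \<Rightarrow> 'e edge_point \<Rightarrow> 'e edge_point" where
  "ep_penrose e H = H\<lparr>model := penrose_contract e (model H)\<rparr>"

definition omega_recursion ::
  "'a::comm_ring_1 \<Rightarrow> 'a \<Rightarrow> 'a \<Rightarrow> 'a \<Rightarrow> 'a \<Rightarrow> ('e edge_point \<Rightarrow> 'a) \<Rightarrow> bool" where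
  "omega_recursion w x y z t F \<longleftrightarrow>
     (\<forall>H. edge_point_graph H \<longrightarrow>
        (\<forall>e \<in> light H.
           F H = w * F (ep_point e H) + x * F (ep_contract e H)
                 + y * F (ep_delete e H) + z * F (ep_penrose e H)) \<and>
        (light H = {} \<longrightarrow> F H = t ^ num_components (model H)))"

text \<open>
  The parameters range over an arbitrary commutative ring; five indeterminates in a polynomial
  ring over the integers give the polynomial itself, other arguments its values. By induction on the
  number of light edges, at most one function on edge-point graphs satisfies the recursion, so
  the choice operator only concerns values at records that are not edge-point graphs. By the same
  uniqueness there is no need to pass to the quotient by equivalence of ribbon graphs and partial
  Petrials of dark edges: a solution on the quotient pulls back to this one.
\<close>

definition Omega ::
  "'e edge_point \<Rightarrow> 'a::comm_ring_1 \<Rightarrow> 'a \<Rightarrow> 'a \<Rightarrow> 'a \<Rightarrow> 'a \<Rightarrow> 'a" where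
  "Omega H w x y z t = (SOME F. omega_recursion w x y z t F) H"


section \<open>The Tutte, Bollobas-Riordan and Penrose polynomials\<close>

definition spanning_subgraph :: "'e ribbon \<Rightarrow> 'e set \<Rightarrow> 'e ribbon" where
  "spanning_subgraph G A = delete (edges G - A) G"

definition kappa :: "'e ribbon \<Rightarrow> 'e set \<Rightarrow> nat" where
  "kappa G A = num_components (spanning_subgraph G A)"

definition bdry :: "'e ribbon \<Rightarrow> 'e set \<Rightarrow> nat" where
  "bdry G A = num_boundaries (spanning_subgraph G A)"

text \<open>
  The subtractions of natural numbers below never truncate: \<open>kappa G A \<le> num_vertices G\<close>,
  \<open>rank G A \<le> card A\<close> and \<open>rank G A \<le> rank G (edges G)\<close> for \<open>A \<subseteq> edges G\<close>.
\<close>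

definition rank :: "'e ribbon \<Rightarrow> 'e set \<Rightarrow> nat" where
  "rank G A = num_vertices G - kappa G A"

definition nullity :: "'e ribbon \<Rightarrow> 'e set \<Rightarrow> nat" where
  "nullity G A = card A - rank G A"

definition tutte :: "'e ribbon \<Rightarrow> 'a::comm_ring_1 \<Rightarrow> 'a \<Rightarrow> 'a" where
  "tutte G x y =
     (\<Sum>A \<in> Pow (edges G). (x - 1) ^ (rank G (edges G) - rank G A) * (y - 1) ^ nullity G A)"

definition bollobas_riordan :: "'e ribbon \<Rightarrow> 'a::field \<Rightarrow> 'a \<Rightarrow> 'a \<Rightarrow> 'a" where
  "bollobas_riordan G x y z =
     (\<Sum>A \<in> Pow (edges G).
        (x - 1) ^ (rank G (edges G) - rank G A) * y ^ nullity G A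
        * z powi (int (kappa G A) - int (bdry G A) + int (nullity G A)))"

definition penrose :: "'e ribbon \<Rightarrow> 'a::comm_ring_1 \<Rightarrow> 'a" where
  "penrose G l = (\<Sum>A \<in> Pow (edges G). (- 1) ^ card A * l ^ num_boundaries (petrial A G))"


section \<open>The topological transition polynomial\<close>

text \<open>
  A checkerboard coloured 4-regular graph with free loops: \<open>links\<close> pairs the two half-edges of
  each edge, and a face corner at a vertex is given by the two half-edges that border it.
\<close>

record ('v, 'h) checkerboard =
  nodes :: "'v set"
  halves :: "'v \<Rightarrow> 'h set"
  links :: "'h rel"
  loops :: nat
  white :: "'v \<Rightarrow> 'h set set"
  black :: "'v \<Rightarrow> 'h set set"

text \<open>
  The medial graph has its vertex \<open>e\<close> at the centre of the edge disc \<open>e\<close>, with one half-edge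
  running to each corner of the disc; from there its edges follow the free arcs around the vertices of
  the ribbon graph. The face between the half-edges to the two corners on a common end of \<open>e\<close>
  contains the vertex at that end, so it is black; the faces along the sides of \<open>e\<close> are white.
\<close>

definition medial :: "'e ribbon \<Rightarrow> ('e, 'e corner) checkerboard" where
  "medial G =
     \<lparr> nodes = edges G,
       halves = (\<lambda>e. corners {e}),
       links = arcs G,
       loops = isolated G,
       white = (\<lambda>e. {{(e, False, s), (e, True, s)} |s. True}),
       black = (\<lambda>e. {{(e, i, False), (e, i, True)} |i. True}) \<rparr>"

datatype transition = White | Black | Crossing

fun joins :: "('v, 'h) checkerboard \<Rightarrow> 'v \<Rightarrow> transition \<Rightarrow> 'h rel" where
  "joins M v White = {(h, k). h \<noteq> k \<and> {h, k} \<in> white M v}"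
| "joins M v Black = {(h, k). h \<noteq> k \<and> {h, k} \<in> black M v}"
| "joins M v Crossing =
     {(h, k). h \<in> halves M v \<and> k \<in> halves M v \<and> h \<noteq> k \<and> {h, k} \<notin> white M v \<union> black M v}"

definition graph_states :: "('v, 'h) checkerboard \<Rightarrow> ('v \<Rightarrow> transition) set" where
  "graph_states M = nodes M \<rightarrow>\<^sub>E UNIV"

definition num_curves :: "('v, 'h) checkerboard \<Rightarrow> ('v \<Rightarrow> transition) \<Rightarrow> nat" where
  "num_curves M s =
     card ((\<Union>v \<in> nodes M. halves M v) // (links M \<union> (\<Union>v \<in> nodes M. joins M v (s v)))\<^sup>*) + loops M"

definition num_choices :: "('v, 'h) checkerboard \<Rightarrow> ('v \<Rightarrow> transition) \<Rightarrow> transition \<Rightarrow> nat" where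
  "num_choices M s c = card {v \<in> nodes M. s v = c}"

definition transition_poly :: "'e ribbon \<Rightarrow> 'a::comm_ring_1 \<times> 'a \<times> 'a \<Rightarrow> 'a \<Rightarrow> 'a" where
  "transition_poly G = (\<lambda>(\<alpha>, \<beta>, \<gamma>) t.
     \<Sum>s \<in> graph_states (medial G).
        \<alpha> ^ num_choices (medial G) s White
        * \<beta> ^ num_choices (medial G) s Black
        * \<gamma> ^ num_choices (medial G) s Crossing
        * t ^ num_curves (medial G) s)"

end

theory Submission
  imports Defs
begin

text \<open>
  If \<open>w = 0\<close>, unfolding the recursion for \<open>\<Omega>\<close> chooses for every edge one of contraction, deletion and
  Penrose contraction. In terms of corners, each of them splices the edge out of the graph: the
  boundary of the vertices is continued along the sides, along the ends or along the diagonals of the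
  edge. Splicing replaces paths of arcs by single arcs and counts the curves that close up, so it
  preserves the number of curves in total (\<open>num_classes_splice\<close>). It also turns a ribbon graph into a ribbon
  graph, because a walk that alternates between two perfect matchings leaves the spliced part at
  a single point, other than its start (\<open>matching_spliced\<close>). A Penrose contraction differs from a contraction only in that
  the corners are renamed by the twist, and this turns the sides into the diagonals. Hence \<open>\<Omega>\<close> is a state
  sum: each choice of a transition at every edge contributes its weight times a power of \<open>t\<close>, whose exponent is the
  number of closed curves formed by the arcs and the chosen connections (\<open>Omega_state_sum\<close>).

  The four claims are readings of this sum. The three connections at an edge are the white, black and
  crossing transitions at the corresponding vertex of the medial graph, so the sum is the topological
  transition polynomial. If black transitions have weight zero, a state is the set of edges with a
  crossing, and its curves are the boundary components of the partial Petrial. If crossings have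
  weight zero, a state is the set \<open>A\<close> of edges with a white transition, and its curves are the boundary
  components of the spanning subgraph on \<open>A\<close>. A comparison of exponents then gives the
  Bollobas-Riordan polynomial.

  In the latter the exponent of \<open>z\<close> is the Euler genus of the spanning subgraph. The Tutte polynomial appears
  for plane graphs because the Euler genus cannot decrease when an edge is added
  (\<open>euler_genus_insert\<close>): it is zero for the edgeless subgraph and, by assumption, for the whole graph, so
  it is zero in between.
\<close>

section \<open>Counting the classes of a generated equivalence\<close>

abbreviation num_classes :: "'c set \<Rightarrow> 'c rel \<Rightarrow> nat" where
  "num_classes C r \<equiv> card (C // r\<^sup>*)"

lemma equiv_rtrancl: "sym r \<Longrightarrow> equiv UNIV (r\<^sup>*)"
  by (simp add: equivI refl_rtrancl sym_rtrancl trans_rtrancl)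

lemma rtrancl_Image_eq:
  assumes "sym r" "(a, b) \<in> r\<^sup>*"
  shows "r\<^sup>* `` {a} = r\<^sup>* `` {b}"
  using equiv_class_eq[OF equiv_rtrancl[OF assms(1)] assms(2)] .

lemma rtrancl_Image_eq_iff:
  assumes "sym r"
  shows "r\<^sup>* `` {a} = r\<^sup>* `` {b} \<longleftrightarrow> (a, b) \<in> r\<^sup>*"
  using eq_equiv_class_iff[OF equiv_rtrancl[OF assms]] by simp

lemma rtrancl_closed:
  assumes "(a, b) \<in> r\<^sup>*" "a \<in> C" "r \<subseteq> C \<times> C"
  shows "b \<in> C"
  using assms by (induction) auto

lemma finite_classes: "finite C \<Longrightarrow> finite (C // r)"
  by (simp add: quotient_def)

lemma coarser_classes:
  assumes "sym r'" "r\<^sup>* \<subseteq> r'\<^sup>*"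
  shows "C // r'\<^sup>* = (\<lambda>K. r'\<^sup>* `` K) ` (C // r\<^sup>*)"
proof -
  have "r'\<^sup>* `` (r\<^sup>* `` {c}) = r'\<^sup>* `` {c}" for c
    using assms(2) by (auto intro: rtrancl_trans)
  then show ?thesis
    unfolding quotient_def by auto
qed

lemma num_classes_antimono:
  assumes "finite C" "sym r'" "r\<^sup>* \<subseteq> r'\<^sup>*"
  shows "num_classes C r' \<le> num_classes C r"
  unfolding coarser_classes[OF assms(2,3)] by (simp add: card_image_le finite_classes assms(1))

lemma num_classes_strict_antimono:
  assumes "finite C" "sym r" "sym r'" "r\<^sup>* \<subseteq> r'\<^sup>*"
    and ab: "a \<in> C" "b \<in> C" "(a, b) \<in> r'\<^sup>*" "(a, b) \<notin> r\<^sup>*"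
  shows "num_classes C r' < num_classes C r"
proof -
  let ?B = "r\<^sup>* `` {b}"
  have absorb: "r'\<^sup>* `` (r\<^sup>* `` {c}) = r'\<^sup>* `` {c}" for c
    using assms(4) by (auto intro: rtrancl_trans)
  have A: "r\<^sup>* `` {a} \<in> C // r\<^sup>* - {?B}"
    using ab rtrancl_Image_eq_iff[OF assms(2)] by (auto intro: quotientI)
  have "r'\<^sup>* `` ?B = r'\<^sup>* `` (r\<^sup>* `` {a})"
    unfolding absorb using rtrancl_Image_eq[OF assms(3) ab(3)] by simp
  then have "C // r'\<^sup>* = (\<lambda>K. r'\<^sup>* `` K) ` (C // r\<^sup>* - {?B})"
    unfolding coarser_classes[OF assms(3,4)] using A by blast
  then have "num_classes C r' \<le> card (C // r\<^sup>* - {?B})"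
    by (simp add: card_image_le finite_classes assms(1))
  also have "\<dots> < num_classes C r"
    using ab(2) by (intro card_Diff1_less) (auto simp: finite_classes assms(1) quotientI)
  finally show ?thesis .
qed

text \<open>
  Generators whose entries all lie in the classes of \<open>a\<close> and \<open>b\<close> merge at most these two classes, so
  the classes other than that of \<open>b\<close> stay distinct.
\<close>

lemma num_classes_le_Suc:
  assumes "finite C" "sym r" "sym S" "S \<subseteq> U \<times> U" "U = r\<^sup>* `` {a} \<union> r\<^sup>* `` {b}"
  shows "num_classes C r \<le> Suc (num_classes C (r \<union> S))"
proof -
  let ?r' = "r \<union> S"
  have symr': "sym ?r'" by (simp add: assms sym_Un)
  have sub: "r\<^sup>* \<subseteq> ?r'\<^sup>*" by (simp add: rtrancl_mono)
  have closed: "v \<in> U" if "u \<in> U" "(u, v) \<in> r\<^sup>*" for u v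
    using that assms(5) by (auto intro: rtrancl_trans)
  have closed': "u \<in> U" if "v \<in> U" "(u, v) \<in> r\<^sup>*" for u v
    using closed that sym_rtrancl[OF assms(2)] by (meson symD)
  have key: "(p, q) \<in> r\<^sup>* \<or> (p \<in> U \<and> q \<in> U)" if "(p, q) \<in> ?r'\<^sup>*" for p q
    using that
  proof induction
    case base then show ?case by simp
  next
    case (step y z)
    from step(2) show ?case
    proof
      assume "(y, z) \<in> r"
      then show ?thesis using step(3) closed by (meson r_into_rtrancl rtrancl.rtrancl_into_rtrancl)
    next
      assume "(y, z) \<in> S"
      then have "y \<in> U" "z \<in> U" using assms(4) by auto
      then show ?thesis using step(3) closed' by blast
    qed
  qed
  let ?B = "r\<^sup>* `` {b}"
  have "inj_on (\<lambda>K. ?r'\<^sup>* `` K) (C // r\<^sup>* - {?B})"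
  proof (rule inj_onI)
    fix K L assume K: "K \<in> C // r\<^sup>* - {?B}" and L: "L \<in> C // r\<^sup>* - {?B}"
      and eq: "?r'\<^sup>* `` K = ?r'\<^sup>* `` L"
    obtain p q where p: "K = r\<^sup>* `` {p}" and q: "L = r\<^sup>* `` {q}"
      using K L by (auto elim!: quotientE)
    have "?r'\<^sup>* `` (r\<^sup>* `` {c}) = ?r'\<^sup>* `` {c}" for c
      using sub by (auto intro: rtrancl_trans)
    then have "(p, q) \<in> ?r'\<^sup>*"
      using eq p q rtrancl_Image_eq_iff[OF symr'] by simp
    moreover have "(b, p) \<notin> r\<^sup>*" "(b, q) \<notin> r\<^sup>*"
      using K L p q rtrancl_Image_eq_iff[OF assms(2)] by auto
    ultimately have "(p, q) \<in> r\<^sup>* \<or> ((a, p) \<in> r\<^sup>* \<and> (a, q) \<in> r\<^sup>*)"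
      using key assms(5) by blast
    then show "K = L"
      unfolding p q using rtrancl_Image_eq[OF assms(2)] by metis
  qed
  then have "card (C // r\<^sup>* - {?B}) \<le> num_classes C ?r'"
    unfolding coarser_classes[OF symr' sub]
    by (intro card_inj_on_le) (auto simp: finite_classes assms(1))
  moreover have "num_classes C r \<le> Suc (card (C // r\<^sup>* - {?B}))"
    using card_Suc_Diff1[of "C // r\<^sup>*" ?B] finite_classes[OF assms(1), of "r\<^sup>*"]
    by (cases "?B \<in> C // r\<^sup>*") auto
  ultimately show ?thesis by linarith
qed

lemma card_quotient_restrict:
  assumes "equiv UNIV r"
  shows "card (X // r) = card (X // (r \<inter> X \<times> X))"
proof -
  have restr: "r `` {a} \<inter> X = (r \<inter> X \<times> X) `` {a}" if "a \<in> X" for a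
    using that by auto
  have "(\<lambda>K. K \<inter> X) ` (X // r) = X // (r \<inter> X \<times> X)"
    using restr by (auto simp: quotient_def image_iff)
  moreover have "inj_on (\<lambda>K. K \<inter> X) (X // r)"
  proof (rule inj_onI)
    fix K L assume "K \<in> X // r" "L \<in> X // r" and eq: "K \<inter> X = L \<inter> X"
    then obtain a b where ab: "a \<in> X" "b \<in> X" "K = r `` {a}" "L = r `` {b}"
      by (auto elim!: quotientE)
    have "(b, b) \<in> r" using assms by (simp add: equiv_def refl_on_def)
    then have "b \<in> K" using ab eq by auto
    then show "K = L"
      using ab equiv_class_eq[OF assms] by auto
  qed
  ultimately show ?thesis by (metis card_image)
qed

lemma card_quotient_cong:
  assumes "equiv UNIV r" "equiv UNIV s"
    and "\<And>a b. a \<in> X \<Longrightarrow> b \<in> X \<Longrightarrow> (a, b) \<in> r \<longleftrightarrow> (a, b) \<in> s"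
  shows "card (X // r) = card (X // s)"
proof -
  have "r \<inter> X \<times> X = s \<inter> X \<times> X" using assms(3) by auto
  then show ?thesis
    using card_quotient_restrict[OF assms(1)] card_quotient_restrict[OF assms(2)] by metis
qed

lemma rtrancl_map_prod:
  "(a, b) \<in> r\<^sup>* \<Longrightarrow> (f a, f b) \<in> (map_prod f f ` r)\<^sup>*"
proof (induction rule: rtrancl_induct)
  case (step y z)
  then have "(f y, f z) \<in> map_prod f f ` r" by (force simp: map_prod_def)
  with step show ?case by (simp add: rtrancl.rtrancl_into_rtrancl)
qed simp

lemma num_classes_involution:
  assumes invol: "\<And>a. f (f a) = a" and C: "f ` C = C"
  shows "num_classes C (map_prod f f ` r) = num_classes C r"
proof -
  let ?s = "map_prod f f ` r"
  have r_eq: "r = map_prod f f ` ?s"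
    by (force simp: image_iff map_prod_def invol)
  have class_image: "?s\<^sup>* `` {f a} = f ` (r\<^sup>* `` {a})" for a
  proof (intro equalityI subsetI)
    fix b assume "b \<in> ?s\<^sup>* `` {f a}"
    then have "(a, f b) \<in> r\<^sup>*"
      using rtrancl_map_prod[of "f a" b ?s f] r_eq invol by simp
    then show "b \<in> f ` (r\<^sup>* `` {a})"
      using invol by (metis Image_singleton_iff image_eqI)
  next
    fix b assume "b \<in> f ` (r\<^sup>* `` {a})"
    then show "b \<in> ?s\<^sup>* `` {f a}" using rtrancl_map_prod[of a _ r f] by auto
  qed
  have "C // ?s\<^sup>* = (f ` C) // ?s\<^sup>*" by (simp add: C)
  also have "\<dots> = (`) f ` (C // r\<^sup>*)"
    by (auto simp: quotient_def class_image)
  finally have "C // ?s\<^sup>* = (`) f ` (C // r\<^sup>*)" .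
  moreover have "inj f" using invol by (metis injI)
  then have "inj_on ((`) f) (C // r\<^sup>*)" by (metis inj_image_eq_iff inj_onI)
  ultimately show ?thesis by (simp add: card_image)
qed


lemma card_eq_sum_blocks:
  assumes "finite X" "finite P" "\<And>v. v \<in> X \<Longrightarrow> \<exists>!K. K \<in> P \<and> Q v K"
  shows "card X = (\<Sum>K \<in> P. card {v \<in> X. Q v K})"
proof -
  have "(\<Sum>K \<in> P. if Q v K then 1 else 0) = (1::nat)" if v: "v \<in> X" for v
  proof -
    obtain K0 where K0: "K0 \<in> P" "Q v K0" "\<And>K. K \<in> P \<Longrightarrow> Q v K \<Longrightarrow> K = K0"
      using assms(3)[OF v] by blast
    have "(\<Sum>K \<in> P. if Q v K then 1 else 0) = (\<Sum>K \<in> P. if K = K0 then 1 else (0::nat))"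
    proof (rule sum.cong)
      fix K assume "K \<in> P"
      then have "Q v K \<longleftrightarrow> K = K0" using K0 by blast
      then show "(if Q v K then 1 else 0) = (if K = K0 then 1 else (0::nat))" by simp
    qed simp
    then show ?thesis using K0(1) assms(2) by simp
  qed
  then have "card X = (\<Sum>v \<in> X. \<Sum>K \<in> P. if Q v K then 1 else 0)" by simp
  also have "\<dots> = (\<Sum>K \<in> P. \<Sum>v \<in> X. if Q v K then 1 else 0)" by (rule sum.swap)
  also have "\<dots> = (\<Sum>K \<in> P. card {v \<in> X. Q v K})"
    using assms(1) by (intro sum.cong refl) (simp add: sum.If_cases Collect_conj_eq)
  finally show ?thesis .
qed


section \<open>Perfect matchings and splicing\<close>

definition perfect_matching :: "'c set \<Rightarrow> 'c rel \<Rightarrow> bool" where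
  "perfect_matching C r \<longleftrightarrow>
     r \<subseteq> C \<times> C \<and> sym r \<and> irrefl r \<and> (\<forall>c \<in> C. \<exists>!d. (c, d) \<in> r)"

lemma
  assumes "perfect_matching C r"
  shows matching_subset: "r \<subseteq> C \<times> C"
    and matching_sym: "sym r"
    and matching_neq: "(a, a) \<notin> r"
    and matching_total: "c \<in> C \<Longrightarrow> \<exists>d. (c, d) \<in> r"
  using assms unfolding perfect_matching_def irrefl_def by blast+

lemma matching_unique:
  assumes "perfect_matching C r" "(c, d) \<in> r" "(c, d') \<in> r"
  shows "d = d'"
  using assms unfolding perfect_matching_def by blast

lemma matching_involutive:
  assumes "perfect_matching C r" "(c, d) \<in> r" "(d, c') \<in> r"
  shows "c' = c"
  using assms matching_unique matching_sym by (metis symD)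

lemma matching_Un:
  assumes "perfect_matching C r" "perfect_matching D s" "C \<inter> D = {}"
  shows "perfect_matching (C \<union> D) (r \<union> s)"
  unfolding perfect_matching_def
proof (intro conjI ballI)
  have sub: "r \<subseteq> C \<times> C" "s \<subseteq> D \<times> D" using matching_subset assms(1,2) by blast+
  then show "r \<union> s \<subseteq> (C \<union> D) \<times> (C \<union> D)" by blast
  show "sym (r \<union> s)" using assms(1,2) matching_sym by (blast intro: sym_Un)
  show "irrefl (r \<union> s)" using assms(1,2) by (simp add: perfect_matching_def irrefl_def)
  fix c assume "c \<in> C \<union> D"
  then show "\<exists>!d. (c, d) \<in> r \<union> s"
  proof
    assume "c \<in> C"
    then have "(c, d) \<in> r \<union> s \<longleftrightarrow> (c, d) \<in> r" for d using sub assms(3) by blast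
    then show ?thesis using assms(1) \<open>c \<in> C\<close> by (simp add: perfect_matching_def)
  next
    assume "c \<in> D"
    then have "(c, d) \<in> r \<union> s \<longleftrightarrow> (c, d) \<in> s" for d using sub assms(3) by blast
    then show ?thesis using assms(2) \<open>c \<in> D\<close> by (simp add: perfect_matching_def)
  qed
qed

lemma relcomp_funpow_shift:
  "M O (N O M) ^^ n = (M O N) ^^ n O M"
proof (induction n)
  case (Suc n)
  have "M O (N O M) ^^ Suc n = (M O (N O M) ^^ n) O (N O M)" by (simp add: O_assoc)
  also have "\<dots> = (M O N) ^^ Suc n O M" by (simp add: Suc.IH O_assoc)
  finally show ?case .
qed simp

text \<open>
  A closed walk that alternates between two matchings and has odd length is a palindrome around
  its middle step. Stripping equal first and last steps leads to a matching edge from a point to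
  itself.
\<close>

lemma no_odd_alternating_cycle:
  assumes "perfect_matching C M" "perfect_matching D N"
  shows "(a, a) \<notin> M O (N O M) ^^ n"
  using assms
proof (induction n arbitrary: C D M N a)
  case 0
  then show ?case using matching_neq[of C M a] by simp
next
  case (Suc n)
  have "(M O N) ^^ Suc n = (M O N) O (M O N) ^^ n"
    by (simp only: relpow.simps relpow_commute)
  then have "M O (N O M) ^^ Suc n = (M O N) O (M O N) ^^ n O M"
    unfolding relcomp_funpow_shift by (simp only: O_assoc)
  also have "\<dots> = M O (N O (M O N) ^^ n) O M" by (simp add: O_assoc)
  finally have eq: "M O (N O M) ^^ Suc n = M O (N O (M O N) ^^ n) O M" .
  show ?case
  proof
    assume "(a, a) \<in> M O (N O M) ^^ Suc n"
    then obtain u v where "(a, u) \<in> M" "(u, v) \<in> N O (M O N) ^^ n" "(v, a) \<in> M"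
      unfolding eq by blast
    moreover from this have "u = v"
      using matching_unique[OF Suc.prems(1)] matching_sym[OF Suc.prems(1)] by (metis symD)
    ultimately show False using Suc.IH[OF Suc.prems(2,1)] by blast
  qed
qed

text \<open>
  Taking \<open>D\<close> out of \<open>C\<close>: the curves follow \<open>\<alpha>\<close>, and whenever they enter \<open>D\<close> they jump along \<open>\<rho>\<close>. The
  new matching joins two points outside \<open>D\<close> that are the ends of such a walk.
\<close>

locale splicing =
  fixes C D :: "'c set" and \<alpha> \<rho> :: "'c rel"
  assumes finite: "finite C" and sub: "D \<subseteq> C"
    and \<alpha>: "perfect_matching C \<alpha>" and \<rho>: "perfect_matching D \<rho>"
begin

definition walks :: "'c rel" where
  "walks = \<alpha> O (\<rho> O \<alpha>)\<^sup>*"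

definition spliced :: "'c rel" where
  "spliced = walks \<inter> (C - D) \<times> (C - D)"

lemma walks_Image:
  "(c, x) \<in> \<alpha> \<Longrightarrow> (c, x) \<in> walks"
  "(c, x) \<in> walks \<Longrightarrow> (x, y) \<in> \<rho> \<Longrightarrow> (y, z) \<in> \<alpha> \<Longrightarrow> (c, z) \<in> walks"
  unfolding walks_def by (auto intro: rtrancl_into_rtrancl)

lemma walks_cases:
  assumes "(c, z) \<in> walks"
  obtains "(c, z) \<in> \<alpha>" | x y where "(c, x) \<in> walks" "(x, y) \<in> \<rho>" "(y, z) \<in> \<alpha>"
  using assms unfolding walks_def by (blast elim: rtranclE)

lemma walks_induct [consumes 1, case_names arc extend]:
  assumes "(c, z) \<in> walks"
    and "\<And>x. (c, x) \<in> \<alpha> \<Longrightarrow> P x"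
    and "\<And>x y z. (c, x) \<in> walks \<Longrightarrow> P x \<Longrightarrow> (x, y) \<in> \<rho> \<Longrightarrow> (y, z) \<in> \<alpha> \<Longrightarrow> P z"
  shows "P z"
proof -
  obtain x where x: "(c, x) \<in> \<alpha>" and "(x, z) \<in> (\<rho> O \<alpha>)\<^sup>*"
    using assms(1) unfolding walks_def by blast
  from this(2) have "P z \<and> (c, z) \<in> walks"
  proof induction
    case base
    then show ?case using assms(2) x walks_Image by blast
  next
    case (step y z)
    then show ?case using assms(3) walks_Image by blast
  qed
  then show ?thesis ..
qed

lemma walks_sym: "sym walks"
proof -
  have "\<alpha>\<inverse> = \<alpha>" "\<rho>\<inverse> = \<rho>"
    using matching_sym \<alpha> \<rho> sym_conv_converse_eq by blast+
  then have "walks\<inverse> = (\<alpha> O \<rho>)\<^sup>* O \<alpha>"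
    by (simp add: walks_def converse_relcomp rtrancl_converse[symmetric])
  also have "\<dots> = walks"
    unfolding walks_def rtrancl_is_UN_relpow relcomp_UNION_distrib relcomp_UNION_distrib2
      relcomp_funpow_shift ..
  finally show ?thesis by (simp add: sym_conv_converse_eq)
qed

text \<open>
  If no walk from \<open>c\<close> left \<open>D\<close>, then one step along \<open>\<rho>\<close> and one along \<open>\<alpha>\<close> would permute the finitely
  many points reached, and the first point reached would also be the end of a longer walk.
  Going back one step along \<open>\<alpha>\<close>, the point \<open>c\<close> would lie in \<open>D\<close>.
\<close>

lemma walk_leaves:
  assumes "c \<in> C - D"
  shows "\<exists>d \<in> C - D. (c, d) \<in> walks"
proof (rule ccontr)
  assume none: "\<not> ?thesis"
  define X where "X = {x. (c, x) \<in> walks}"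
  have "X \<subseteq> C"
    unfolding X_def using matching_subset[OF \<alpha>] by (auto elim: walks_cases)
  then have XD: "X \<subseteq> D" using none X_def by blast
  have finX: "finite X" using \<open>X \<subseteq> C\<close> finite by (rule finite_subset)
  obtain a where a: "\<And>x. x \<in> C \<Longrightarrow> (x, a x) \<in> \<alpha>" using matching_total[OF \<alpha>] by metis
  obtain r where r: "\<And>x. x \<in> D \<Longrightarrow> (x, r x) \<in> \<rho>" using matching_total[OF \<rho>] by metis
  have rD: "r x \<in> D" if "x \<in> D" for x using r[OF that] matching_subset[OF \<rho>] by blast
  have inja: "x = y" if "x \<in> C" "y \<in> C" "a x = a y" for x y
    using a[OF that(1)] a[OF that(2)] that(3) matching_involutive [OF \<alpha>] matching_sym[OF \<alpha>]
    by (metis symD)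
  have injr: "x = y" if "x \<in> D" "y \<in> D" "r x = r y" for x y
    using r[OF that(1)] r[OF that(2)] that(3) matching_involutive [OF \<rho>] matching_sym[OF \<rho>]
    by (metis symD)
  have "(a \<circ> r) ` X \<subseteq> X"
    using XD a r rD sub walks_Image(2) unfolding X_def by fastforce
  moreover have "inj_on (a \<circ> r) X"
  proof (rule inj_onI)
    fix x y assume "x \<in> X" "y \<in> X" "(a \<circ> r) x = (a \<circ> r) y"
    then have "x \<in> D" "y \<in> D" "a (r x) = a (r y)" using XD by auto
    then show "x = y" using inja[of "r x" "r y"] injr[of x y] rD sub by blast
  qed
  ultimately have "(a \<circ> r) ` X = X" by (rule endo_inj_surj[OF finX])
  moreover have "a c \<in> X" using a assms walks_Image(1) X_def by blast
  ultimately obtain x where x: "x \<in> X" "a c = a (r x)" by auto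
  then have "c = r x" using inja[of c "r x"] assms XD rD sub by blast
  then show False using assms x XD rD by blast
qed

text \<open>
  Both matchings are functional, so of two walks from \<open>c\<close> one continues the other, and no walk can be
  continued along \<open>\<rho>\<close> from a point outside \<open>D\<close>.
\<close>

lemma walk_unique:
  assumes "d \<in> C - D" "(c, d) \<in> walks" "d' \<in> C - D" "(c, d') \<in> walks"
  shows "d' = d"
proof -
  have "(d', d) \<in> (\<rho> O \<alpha>)\<^sup>*"
    using assms(4)
  proof (induction rule: walks_induct)
    case (arc x)
    then show ?case using assms(2) matching_unique[OF \<alpha>] unfolding walks_def by blast
  next
    case (extend x y z)
    have "x \<noteq> d" using extend.hyps(2) matching_subset[OF \<rho>] assms(1) by blast
    with extend.IH obtain y' z' where "(x, y') \<in> \<rho>" "(y', z') \<in> \<alpha>" "(z', d) \<in> (\<rho> O \<alpha>)\<^sup>*"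
      by (auto elim: converse_rtranclE)
    then show ?case
      using extend.hyps(2,3) matching_unique[OF \<rho>] matching_unique[OF \<alpha>] by metis
  qed
  then show ?thesis
    using assms(3) matching_subset[OF \<rho>] by (auto elim: converse_rtranclE)
qed

lemma matching_spliced: "perfect_matching (C - D) spliced"
proof -
  have "(a, a) \<notin> walks" for a
    using no_odd_alternating_cycle[OF \<alpha> \<rho>] unfolding walks_def rtrancl_is_UN_relpow by blast
  then have "irrefl spliced" by (auto simp: irrefl_def spliced_def)
  moreover have "sym spliced"
    using walks_sym by (auto simp: sym_def spliced_def)
  moreover have "\<exists>!d. (c, d) \<in> spliced" if "c \<in> C - D" for c
    using walk_leaves[OF that] walk_unique that unfolding spliced_def by blast
  ultimately show ?thesis
    unfolding perfect_matching_def by (auto simp: spliced_def)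
qed

lemma walks_connected: "walks \<subseteq> (\<rho> \<union> \<alpha>)\<^sup>*"
proof
  fix p assume "p \<in> walks"
  then obtain c z where p: "p = (c, z)" "(c, z) \<in> walks" by (cases p) auto
  from p(2) have "(c, z) \<in> (\<rho> \<union> \<alpha>)\<^sup>*"
    by (induction rule: walks_induct) (auto intro: rtrancl_into_rtrancl)
  then show "p \<in> (\<rho> \<union> \<alpha>)\<^sup>*" using p by simp
qed

text \<open>
  Repeated steps along the same matching cancel, so a path may be taken to alternate. Away from
  \<open>D\<close> it must start, and end, with a step along \<open>\<alpha>\<close>.
\<close>

lemma connected_outside:
  assumes "c \<in> C - D" "d \<in> C - D" "(c, d) \<in> (\<rho> \<union> \<alpha>)\<^sup>*"
  shows "c = d \<or> (c, d) \<in> spliced"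
proof -
  from assms(3) have "c = d \<or> (c, d) \<in> walks \<or> (c, d) \<in> walks O \<rho>"
  proof induction
    case (step y z)
    have \<rho>step: "z = c \<or> (c, z) \<in> walks \<or> (c, z) \<in> walks O \<rho>" if "(y, z) \<in> \<rho>"
      using step(3)
    proof (elim disjE)
      assume "c = y"
      then show ?thesis using that assms(1) matching_subset[OF \<rho>] by blast
    next
      assume "(c, y) \<in> walks O \<rho>"
      then show ?thesis using that matching_involutive[OF \<rho>] by blast
    qed (use that in blast)
    have \<alpha>step: "z = c \<or> (c, z) \<in> walks \<or> (c, z) \<in> walks O \<rho>" if "(y, z) \<in> \<alpha>"
      using step(3)
    proof (elim disjE)
      assume "c = y"
      then show ?thesis using that walks_Image(1) by blast
    next
      assume "(c, y) \<in> walks"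
      then show ?thesis
        by (cases rule: walks_cases) (use that matching_involutive[OF \<alpha>] in blast)+
    next
      assume "(c, y) \<in> walks O \<rho>"
      then show ?thesis using that walks_Image(2) by blast
    qed
    from step(2) show ?case using \<rho>step \<alpha>step by blast
  qed simp
  then show ?thesis
    using assms matching_subset[OF \<rho>] unfolding spliced_def by blast
qed

text \<open>
  Further generators \<open>R\<close> that avoid \<open>D\<close> cannot tell the spliced matching from the paths that it
  shortcuts. Only the classes that never leave \<open>D\<close> are lost.
\<close>

lemma num_classes_splice:
  assumes "R \<subseteq> (C - D) \<times> (C - D)" "sym R"
  shows "num_classes C (R \<union> \<rho> \<union> \<alpha>)
    = num_classes (C - D) (R \<union> spliced) + card {K \<in> C // (\<rho> \<union> \<alpha>)\<^sup>*. K \<subseteq> D}"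
proof -
  let ?T = "R \<union> \<rho> \<union> \<alpha>" and ?Q = "R \<union> spliced"
  have symT: "sym ?T" and symQ: "sym ?Q" and sym\<rho>\<alpha>: "sym (\<rho> \<union> \<alpha>)"
    using assms(2) matching_sym \<alpha> \<rho> matching_spliced by (blast intro: sym_Un)+
  have TC: "?T \<subseteq> C \<times> C"
    using assms(1) matching_subset[OF \<alpha>] matching_subset[OF \<rho>] sub by blast
  have QT: "(a, b) \<in> ?T\<^sup>*" if "(a, b) \<in> ?Q\<^sup>*" for a b
  proof -
    have "(\<rho> \<union> \<alpha>)\<^sup>* \<subseteq> ?T\<^sup>*" by (intro rtrancl_mono) auto
    then have "?Q \<subseteq> ?T\<^sup>*" using walks_connected unfolding spliced_def by auto
    then show ?thesis using that rtrancl_subset_rtrancl by blast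
  qed
  have outside: "(a, b) \<in> ?Q\<^sup>*" if "a \<in> C - D" "b \<in> C - D" "(a, b) \<in> (\<rho> \<union> \<alpha>)\<^sup>*" for a b
    using connected_outside[OF that] by auto
  have TQ: "(a, b) \<in> ?Q\<^sup>*" if "a \<in> C - D" "b \<in> C - D" "(a, b) \<in> ?T\<^sup>*" for a b
  proof -
    \<comment> \<open>The invariant speaks of all points outside \<open>D\<close> that can be reached without \<open>R\<close>.\<close>
    from that(3) have "\<forall>y \<in> C - D. (b, y) \<in> (\<rho> \<union> \<alpha>)\<^sup>* \<longrightarrow> (a, y) \<in> ?Q\<^sup>*"
    proof induction
      case base
      then show ?case using outside that(1) by blast
    next
      case (step u v)
      show ?case
      proof (intro ballI impI)
        fix y assume y: "y \<in> C - D" "(v, y) \<in> (\<rho> \<union> \<alpha>)\<^sup>*"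
        show "(a, y) \<in> ?Q\<^sup>*"
        proof (cases "(u, v) \<in> R")
          case True
          then have uv: "u \<in> C - D" "v \<in> C - D" using assms(1) by auto
          then have "(a, u) \<in> ?Q\<^sup>*" using step(3) by blast
          then have "(a, v) \<in> ?Q\<^sup>*" using True by (simp add: rtrancl_into_rtrancl)
          then show ?thesis using outside[OF uv(2) y] by (rule rtrancl_trans)
        next
          case False
          then have "(u, y) \<in> (\<rho> \<union> \<alpha>)\<^sup>*"
            using step(2) y(2) by (intro converse_rtrancl_into_rtrancl[of u v]) auto
          then show ?thesis using step(3) y(1) by blast
        qed
      qed
    qed
    then show ?thesis using that(2) by blast
  qed
  have "{K \<in> C // ?T\<^sup>*. \<not> K \<subseteq> D} = (C - D) // ?T\<^sup>*"
  proof (intro equalityI subsetI)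
    fix K assume "K \<in> {K \<in> C // ?T\<^sup>*. \<not> K \<subseteq> D}"
    then obtain c d where K: "c \<in> C" "K = ?T\<^sup>* `` {c}" "d \<in> K" "d \<notin> D"
      by (auto elim!: quotientE)
    then have "d \<in> C - D" using rtrancl_closed[OF _ _ TC] by blast
    moreover have "K = ?T\<^sup>* `` {d}" using K rtrancl_Image_eq[OF symT] by simp
    ultimately show "K \<in> (C - D) // ?T\<^sup>*" by (simp add: quotientI)
  next
    fix K assume "K \<in> (C - D) // ?T\<^sup>*"
    then show "K \<in> {K \<in> C // ?T\<^sup>*. \<not> K \<subseteq> D}" by (auto simp: quotient_def)
  qed
  then have out: "card {K \<in> C // ?T\<^sup>*. \<not> K \<subseteq> D} = num_classes (C - D) ?Q"
    using card_quotient_cong[OF equiv_rtrancl[OF symT] equiv_rtrancl[OF symQ], of "C - D"] QT TQ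
    by (simp only:) blast
  have same: "?T\<^sup>* `` {c} = (\<rho> \<union> \<alpha>)\<^sup>* `` {c}" if "(\<rho> \<union> \<alpha>)\<^sup>* `` {c} \<subseteq> D" for c
  proof (intro equalityI subsetI)
    fix b assume "b \<in> ?T\<^sup>* `` {c}"
    then have "(c, b) \<in> ?T\<^sup>*" by simp
    then show "b \<in> (\<rho> \<union> \<alpha>)\<^sup>* `` {c}"
    proof induction
      case (step u v)
      then have "u \<in> D" using that by blast
      then have "(u, v) \<in> \<rho> \<union> \<alpha>" using step(2) assms(1) by blast
      then show ?case using step(3) by (auto intro: rtrancl_into_rtrancl)
    qed simp
  next
    fix b assume "b \<in> (\<rho> \<union> \<alpha>)\<^sup>* `` {c}"
    moreover have "(\<rho> \<union> \<alpha>)\<^sup>* \<subseteq> ?T\<^sup>*" by (intro rtrancl_mono) auto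
    ultimately show "b \<in> ?T\<^sup>* `` {c}" by blast
  qed
  have le: "(\<rho> \<union> \<alpha>)\<^sup>* `` {c} \<subseteq> ?T\<^sup>* `` {c}" for c
    using rtrancl_mono[of "\<rho> \<union> \<alpha>" ?T] by blast
  have "?T\<^sup>* `` {c} = (\<rho> \<union> \<alpha>)\<^sup>* `` {c}" if "?T\<^sup>* `` {c} \<subseteq> D" for c
    using same le that by (meson order_trans)
  then have "{K \<in> C // ?T\<^sup>*. K \<subseteq> D} = {K \<in> C // (\<rho> \<union> \<alpha>)\<^sup>*. K \<subseteq> D}"
    using same by (auto simp: quotient_def)
  moreover have "num_classes C ?T = card {K \<in> C // ?T\<^sup>*. \<not> K \<subseteq> D} + card {K \<in> C // ?T\<^sup>*. K \<subseteq> D}"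
    using finite_classes[OF finite] by (subst card_Un_disjoint[symmetric]) (auto intro: arg_cong[where f = card])
  ultimately show ?thesis using out by simp
qed

end


section \<open>Splicing and twisting ribbon graphs\<close>

lemma corners_iff: "c \<in> corners A \<longleftrightarrow> fst c \<in> A"
  by (cases c) (simp add: corners_def)

lemma corners_Diff: "corners (A - B) = corners A - corners B"
  by (auto simp: corners_iff)

lemma finite_corners: "finite A \<Longrightarrow> finite (corners A)"
  by (simp add: corners_def)

lemma ribbon_graph_iff:
  "ribbon_graph G \<longleftrightarrow> finite (edges G) \<and> perfect_matching (corners (edges G)) (arcs G)"
  by (auto simp: ribbon_graph_def perfect_matching_def)

definition crossings :: "'e set \<Rightarrow> 'e corner rel" where
  "crossings A = {((e, i, s), (e, \<not> i, \<not> s)) |e i s. e \<in> A}"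

text \<open>
  Contraction, deletion and Penrose contraction of an edge splice it out along its sides, its ends
  and its diagonals. These are the three ways in which a graph state resolves the vertex of the
  medial graph that lies on the edge.
\<close>

fun join :: "transition \<Rightarrow> 'e set \<Rightarrow> 'e corner rel" where
  "join White A = sides A"
| "join Black A = ends A"
| "join Crossing A = crossings A"

lemma join_iff:
  "((e, i, s), (e', i', s')) \<in> ends A \<longleftrightarrow> e \<in> A \<and> e' = e \<and> i' = i \<and> s' = (\<not> s)"
  "((e, i, s), (e', i', s')) \<in> sides A \<longleftrightarrow> e \<in> A \<and> e' = e \<and> i' = (\<not> i) \<and> s' = s"
  "((e, i, s), (e', i', s')) \<in> crossings A \<longleftrightarrow> e \<in> A \<and> e' = e \<and> i' = (\<not> i) \<and> s' = (\<not> s)"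
  by (auto simp: ends_def sides_def crossings_def)

lemma matching_join: "perfect_matching (corners A) (join c A)"
  unfolding perfect_matching_def sym_def irrefl_def
  by (cases c) (auto simp: corners_def join_iff)

lemma join_Un: "join c (A \<union> B) = join c A \<union> join c B"
  by (cases c) (auto simp: ends_def sides_def crossings_def)

lemma join_empty: "join c {} = {}"
  by (cases c) (auto simp: ends_def sides_def crossings_def)

lemma join_UN: "join c A = (\<Union>e \<in> A. join c {e})"
  by (cases c) (auto simp: ends_def sides_def crossings_def)

lemmas ends_matching = matching_join[of _ Black, unfolded join.simps]
lemmas sides_matching = matching_join[of _ White, unfolded join.simps]

lemma corners_mono: "A \<subseteq> B \<Longrightarrow> corners A \<subseteq> corners B"
  by (auto simp: corners_iff)

lemma join_subset: "join c A \<subseteq> corners A \<times> corners A"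
  using matching_subset[OF matching_join] .

lemma sym_join: "sym (join c A)"
  using matching_sym[OF matching_join] .

lemma edges_splice: "edges (splice \<rho> B G) = edges G - B"
  by (simp add: splice_def)

context
  fixes G :: "'e ribbon" and B :: "'e set" and \<rho> :: "'e corner rel"
  assumes G: "ribbon_graph G" and B: "B \<subseteq> edges G"
    and \<rho>: "perfect_matching (corners B) \<rho>"
begin

interpretation splicing "corners (edges G)" "corners B" "arcs G" \<rho>
  using G B \<rho> by unfold_locales (auto simp: ribbon_graph_iff finite_corners corners_mono)

lemma arcs_splice: "arcs (splice \<rho> B G) = spliced"
  by (simp add: splice_def spliced_def walks_def corners_Diff)

lemma ribbon_graph_splice: "ribbon_graph (splice \<rho> B G)"
  using matching_spliced G
  by (simp add: ribbon_graph_iff arcs_splice edges_splice corners_Diff)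

lemma num_classes_splice_ribbon:
  assumes "R \<subseteq> corners (edges G - B) \<times> corners (edges G - B)" "sym R"
  shows "num_classes (corners (edges (splice \<rho> B G))) (R \<union> arcs (splice \<rho> B G))
      + isolated (splice \<rho> B G)
    = num_classes (corners (edges G)) (R \<union> \<rho> \<union> arcs G) + isolated G"
proof -
  have "isolated (splice \<rho> B G)
      = isolated G + card {K \<in> corners (edges G) // (\<rho> \<union> arcs G)\<^sup>*. K \<subseteq> corners B}"
    by (simp add: splice_def)
  then show ?thesis
    using num_classes_splice[of R] assms by (simp add: arcs_splice edges_splice corners_Diff)
qed

text \<open>
  An arc of the spliced graph is a path in the old one, and it never closes up.
\<close>

lemma splice_partner:
  assumes "c \<in> corners (edges G - B)"
  obtains d where "d \<in> corners (edges G - B)" "d \<noteq> c" "(c, d) \<in> (\<rho> \<union> arcs G)\<^sup>*"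
proof -
  have c: "c \<in> corners (edges G) - corners B" using assms by (simp add: corners_Diff)
  obtain d where d: "(c, d) \<in> spliced"
    using matching_total[OF matching_spliced c] by blast
  have "d \<noteq> c" using d matching_neq[OF matching_spliced] by blast
  moreover have "d \<in> corners (edges G - B)"
    using d matching_subset[OF matching_spliced] by (auto simp: corners_Diff)
  moreover have "(c, d) \<in> (\<rho> \<union> arcs G)\<^sup>*"
    using d walks_connected by (auto simp: spliced_def)
  ultimately show ?thesis using that by blast
qed

end

lemma twist_twist: "twist A (twist A c) = c"
  by (cases c) (auto simp: twist_def)

lemma twist_apply: "twist A (e, i, s) = (e, i, if e \<in> A \<and> i then \<not> s else s)"
  by (simp add: twist_def)

lemma twist_in_corners: "twist A c \<in> corners B \<longleftrightarrow> c \<in> corners B"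
  by (cases c) (auto simp: twist_def corners_iff)

lemma twist_corners: "twist A ` corners B = corners B"
proof (intro equalityI subsetI)
  fix c assume "c \<in> corners B"
  then have "twist A (twist A c) \<in> twist A ` corners B" 
    using twist_in_corners by (intro imageI) blast
  then show "c \<in> twist A ` corners B" by (simp only: twist_twist)
next
  fix c assume "c \<in> twist A ` corners B"
  then obtain d where "c = twist A d" "d \<in> corners B" by (rule imageE)
  then show "c \<in> corners B" using twist_in_corners by blast
qed

abbreviation retwist :: "'e set \<Rightarrow> 'e corner rel \<Rightarrow> 'e corner rel" where
  "retwist A r \<equiv> map_prod (twist A) (twist A) ` r"

lemma retwist_iff: "(c, d) \<in> retwist A r \<longleftrightarrow> (twist A c, twist A d) \<in> r"
proof
  assume "(twist A c, twist A d) \<in> r"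
  then have "map_prod (twist A) (twist A) (twist A c, twist A d) \<in> retwist A r" by (rule imageI)
  then show "(c, d) \<in> retwist A r" by (simp only: map_prod_simp twist_twist)
next
  assume "(c, d) \<in> retwist A r"
  then obtain c' d' where "(c', d') \<in> r" "c = twist A c'" "d = twist A d'" by auto
  then show "(twist A c, twist A d) \<in> r" by (simp only: twist_twist)
qed

lemma retwist_disjoint:
  assumes "r \<subseteq> corners B \<times> corners B" "A \<inter> B = {}"
  shows "retwist A r = r"
proof -
  have fixed: "twist A c = c" if "c \<in> corners B" for c
    using that assms(2) by (cases c) (auto simp: twist_def corners_iff)
  have "(c, d) \<in> retwist A r \<longleftrightarrow> (c, d) \<in> r" for c d
  proof -
    have "(twist A c, twist A d) \<in> r \<longleftrightarrow> (c, d) \<in> r" if "c \<in> corners B" "d \<in> corners B"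
      using that by (simp only: fixed)
    moreover have "(twist A c, twist A d) \<notin> r \<and> (c, d) \<notin> r" if "\<not> (c \<in> corners B \<and> d \<in> corners B)"
      using that assms(1) twist_in_corners by blast
    ultimately show ?thesis unfolding retwist_iff by blast
  qed
  then show ?thesis by (simp only: set_eq_iff split_paired_All) simp
qed

text \<open>
  A half-twist exchanges the sides of an edge with its diagonals and keeps its ends. This is why Penrose
  contraction corresponds to crossings.
\<close>

lemma retwist_joins:
  "retwist A (ends A) = ends A"
  "retwist A (sides A) = crossings A"
  "retwist A (crossings A) = sides A"
  by (auto simp only: set_eq_iff split_paired_all split_paired_All retwist_iff twist_apply
      join_iff split: if_splits)

lemma ribbon_graph_petrial:
  assumes "ribbon_graph G"
  shows "ribbon_graph (petrial A G)"
proof -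
  let ?C = "corners (edges G)"
  have m: "perfect_matching ?C (arcs G)" using assms by (simp add: ribbon_graph_iff)
  have "\<exists>!d. (c, d) \<in> retwist A (arcs G)" if "c \<in> ?C" for c
  proof -
    have "twist A c \<in> ?C" using that by (simp add: twist_in_corners)
    then obtain d where "(twist A c, d) \<in> arcs G" using matching_total[OF m] by blast
    then show ?thesis
      unfolding retwist_iff using matching_unique[OF m] twist_twist by metis
  qed
  moreover have "retwist A (arcs G) \<subseteq> ?C \<times> ?C"
    using matching_subset[OF m] by (auto simp: twist_in_corners)
  moreover have "sym (retwist A (arcs G))" "irrefl (retwist A (arcs G))"
    using matching_sym[OF m] matching_neq[OF m]
    unfolding sym_def irrefl_def retwist_iff by blast+
  ultimately show ?thesis
    using assms by (simp add: ribbon_graph_iff perfect_matching_def petrial_def)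
qed

text \<open>
  Instead of reattaching the edges of \<open>A\<close>, one may rename their corners and keep the arcs. The twist is an
  involution, so the number of classes is unaffected.
\<close>

lemma num_classes_petrial:
  "num_classes (corners (edges G)) (R \<union> arcs (petrial A G))
    = num_classes (corners (edges G)) (retwist A R \<union> arcs G)"
proof -
  have "retwist A (retwist A R \<union> arcs G) = R \<union> arcs (petrial A G)"
    by (auto simp: set_eq_iff retwist_iff petrial_def twist_twist)
  then show ?thesis
    using num_classes_involution[of "twist A", OF twist_twist twist_corners] by metis
qed


section \<open>The state sum for \<open>\<Omega>\<close>\<close>

definition state_joins :: "'e set \<Rightarrow> ('e \<Rightarrow> transition) \<Rightarrow> 'e corner rel" where
  "state_joins A s = (\<Union>e \<in> A. join (s e) {e})"

text \<open>
  The dark edges are kept whole: each of them holds its four corners together, as a singular point does.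
\<close>

definition state_curves :: "'e edge_point \<Rightarrow> ('e \<Rightarrow> transition) \<Rightarrow> nat" where
  "state_curves H s =
     num_classes (corners (edges (model H)))
       (ends (dark H) \<union> sides (dark H) \<union> state_joins (light H) s \<union> arcs (model H))
     + isolated (model H)"

definition state_sum :: "(transition \<Rightarrow> 'a::comm_ring_1) \<Rightarrow> 'a \<Rightarrow> 'e edge_point \<Rightarrow> 'a" where
  "state_sum wt t H =
     (\<Sum>s \<in> light H \<rightarrow>\<^sub>E UNIV. (\<Prod>e \<in> light H. wt (s e)) * t ^ state_curves H s)"

lemma state_joins_subset: "state_joins A s \<subseteq> corners A \<times> corners A"
proof
  fix p assume "p \<in> state_joins A s"
  then obtain e where "e \<in> A" "p \<in> join (s e) {e}" by (auto simp: state_joins_def)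
  then show "p \<in> corners A \<times> corners A"
    using join_subset[of "s e" "{e}"] corners_mono[of "{e}" A] by blast
qed

lemma sym_state_joins: "sym (state_joins A s)"
  unfolding state_joins_def using sym_join by (intro sym_UNION) blast

lemma state_joins_update:
  assumes "e \<in> A"
  shows "state_joins A (s(e := c)) = state_joins (A - {e}) s \<union> join c {e}"
proof -
  have "state_joins A (s(e := c)) = join ((s(e := c)) e) {e} \<union> (\<Union>f \<in> A - {e}. join ((s(e := c)) f) {f})"
    unfolding state_joins_def using assms by blast
  then show ?thesis by (simp add: state_joins_def Un_commute)
qed

lemma state_joins_two:
  assumes "A \<subseteq> E"
  shows "state_joins E (\<lambda>e \<in> E. if e \<in> A then c else d) = join c A \<union> join d (E - A)"
proof -
  let ?s = "\<lambda>e \<in> E. if e \<in> A then c else d"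
  have "state_joins E ?s = (\<Union>e \<in> A. join (?s e) {e}) \<union> (\<Union>e \<in> E - A. join (?s e) {e})"
    unfolding state_joins_def using assms by blast
  also have "(\<Union>e \<in> A. join (?s e) {e}) = (\<Union>e \<in> A. join c {e})"
    using assms by (intro SUP_cong) auto
  also have "(\<Union>e \<in> E - A. join (?s e) {e}) = (\<Union>e \<in> E - A. join d {e})"
    by (intro SUP_cong) auto
  finally show ?thesis unfolding join_UN[of c A] join_UN[of d "E - A"] .
qed

text \<open>
  Away from \<open>e\<close> a state only uses corners that survive when \<open>e\<close> is spliced out, so there its connections can be
  carried over to the smaller graph.
\<close>

lemma state_rest:
  fixes H :: "'e edge_point" and s :: "'e \<Rightarrow> transition"
  assumes "edge_point_graph H" "e \<in> light H"
  defines "R \<equiv> ends (dark H) \<union> sides (dark H) \<union> state_joins (light H - {e}) s"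
  shows "R \<subseteq> corners (edges (model H) - {e}) \<times> corners (edges (model H) - {e})" "sym R"
proof -
  let ?E' = "edges (model H) - {e}"
  have "dark H \<subseteq> ?E'" "light H - {e} \<subseteq> ?E'"
    using assms by (auto simp: edge_point_graph_def light_def)
  then have "corners (dark H) \<subseteq> corners ?E'" "corners (light H - {e}) \<subseteq> corners ?E'"
    by (simp_all add: corners_mono)
  then show "R \<subseteq> corners ?E' \<times> corners ?E'"
    unfolding R_def
    using join_subset[of Black "dark H"] join_subset[of White "dark H"]
      state_joins_subset[of "light H - {e}" s] by (simp only: join.simps) blast
  show "sym R"
    unfolding R_def using sym_join[of Black "dark H"] sym_join[of White "dark H"] sym_state_joins
    by (simp only: join.simps) (intro sym_Un)
qed

lemma state_curves_splice:
  assumes H: "edge_point_graph H" and e: "e \<in> light H"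
  shows "state_curves H (s(e := c))
    = state_curves (H\<lparr>model := splice (join c {e}) {e} (model H)\<rparr>) s"
proof -
  let ?R = "ends (dark H) \<union> sides (dark H) \<union> state_joins (light H - {e}) s"
  let ?H' = "H\<lparr>model := splice (join c {e}) {e} (model H)\<rparr>"
  have light': "light ?H' = light H - {e}"
    by (auto simp: light_def edges_splice)
  have G: "ribbon_graph (model H)" "{e} \<subseteq> edges (model H)"
    using H e by (auto simp: edge_point_graph_def light_def)
  have "state_curves ?H' s
      = num_classes (corners (edges (model H))) (?R \<union> join c {e} \<union> arcs (model H)) + isolated (model H)"
    unfolding state_curves_def light'
    using num_classes_splice_ribbon[OF G matching_join state_rest[OF H e]]
    by simp
  then show ?thesis
    using e by (simp add: state_curves_def state_joins_update Un_assoc)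
qed

lemma state_curves_petrial:
  assumes H: "edge_point_graph H" and e: "e \<in> light H"
  shows "state_curves (H\<lparr>model := petrial {e} (model H)\<rparr>) (s(e := White))
    = state_curves H (s(e := Crossing))"
proof -
  let ?R = "ends (dark H) \<union> sides (dark H) \<union> state_joins (light H - {e}) s"
  let ?H' = "H\<lparr>model := petrial {e} (model H)\<rparr>"
  have light': "light ?H' = light H"
    by (simp add: light_def petrial_def)
  have "retwist {e} ?R = ?R"
    by (rule retwist_disjoint[OF state_rest(1)[OF H e]]) auto
  then have "retwist {e} (?R \<union> sides {e}) = ?R \<union> crossings {e}"
    unfolding image_Un[of _ ?R] retwist_joins by simp
  then have "num_classes (corners (edges (model H))) (?R \<union> sides {e} \<union> arcs (petrial {e} (model H)))
      = num_classes (corners (edges (model H))) (?R \<union> crossings {e} \<union> arcs (model H))"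
    unfolding num_classes_petrial by simp
  then show ?thesis
    using e unfolding state_curves_def light'
    by (simp add: state_joins_update Un_assoc petrial_def)
qed

lemma UNIV_transition: "UNIV = {White, Black, Crossing}"
proof (rule UNIV_eq_I)
  fix c show "c \<in> {White, Black, Crossing}" by (cases c) simp_all
qed

lemma sum_states_insert:
  fixes g :: "('e \<Rightarrow> transition) \<Rightarrow> 'a::comm_ring_1"
  assumes "e \<notin> A"
  shows "(\<Sum>s \<in> insert e A \<rightarrow>\<^sub>E UNIV. g s)
    = (\<Sum>s \<in> A \<rightarrow>\<^sub>E UNIV. g (s(e := White)))
      + (\<Sum>s \<in> A \<rightarrow>\<^sub>E UNIV. g (s(e := Black)))
      + (\<Sum>s \<in> A \<rightarrow>\<^sub>E UNIV. g (s(e := Crossing)))"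
proof -
  have "(\<Sum>s \<in> insert e A \<rightarrow>\<^sub>E UNIV. g s)
      = (\<Sum>(c, s) \<in> UNIV \<times> (A \<rightarrow>\<^sub>E UNIV). g (s(e := c)))"
  proof -
    have "inj_on (\<lambda>(c, s). s(e := c)) ((UNIV :: transition set) \<times> (A \<rightarrow>\<^sub>E UNIV))"
      by (rule inj_combinator[OF assms])
    then show ?thesis
      unfolding PiE_insert_eq by (simp only: sum.reindex) (simp only: o_def case_prod_unfold)
  qed
  also have "\<dots> = (\<Sum>c \<in> UNIV. \<Sum>s \<in> A \<rightarrow>\<^sub>E UNIV. g (s(e := c)))"
    by (rule sum.cartesian_product[symmetric])
  also have "\<dots> = (\<Sum>s \<in> A \<rightarrow>\<^sub>E UNIV. g (s(e := White)))
      + (\<Sum>s \<in> A \<rightarrow>\<^sub>E UNIV. g (s(e := Black)))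
      + (\<Sum>s \<in> A \<rightarrow>\<^sub>E UNIV. g (s(e := Crossing)))"
    by (subst (1) UNIV_transition) (simp add: add.assoc)
  finally show ?thesis .
qed

lemma edge_point_minors:
  assumes H: "edge_point_graph H" and e: "e \<in> light H"
  shows "edge_point_graph (ep_contract e H)" "light (ep_contract e H) = light H - {e}"
    and "edge_point_graph (ep_delete e H)" "light (ep_delete e H) = light H - {e}"
    and "edge_point_graph (ep_penrose e H)" "light (ep_penrose e H) = light H - {e}"
proof -
  have G: "ribbon_graph (model H)" "{e} \<subseteq> edges (model H)" and D: "dark H \<subseteq> edges (model H) - {e}"
    using H e by (auto simp: edge_point_graph_def light_def)
  have G': "ribbon_graph (petrial {e} (model H))" "{e} \<subseteq> edges (petrial {e} (model H))"
    using G ribbon_graph_petrial by (auto simp: petrial_def)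
  show "edge_point_graph (ep_contract e H)" "edge_point_graph (ep_delete e H)"
    "edge_point_graph (ep_penrose e H)"
    using D ribbon_graph_splice[OF G matching_join[of _ White]]
      ribbon_graph_splice[OF G matching_join[of _ Black]]
      ribbon_graph_splice[OF G' matching_join[of _ White]]
    by (simp_all add: edge_point_graph_def ep_contract_def contract_def ep_delete_def delete_def
        ep_penrose_def penrose_contract_def edges_splice petrial_def)
  show "light (ep_contract e H) = light H - {e}" "light (ep_delete e H) = light H - {e}"
    "light (ep_penrose e H) = light H - {e}"
    by (auto simp: light_def ep_contract_def contract_def ep_delete_def delete_def
        ep_penrose_def penrose_contract_def edges_splice petrial_def)
qed

lemma state_curves_minors:
  assumes H: "edge_point_graph H" and e: "e \<in> light H"
  shows "state_curves H (s(e := White)) = state_curves (ep_contract e H) s"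
    and "state_curves H (s(e := Black)) = state_curves (ep_delete e H) s"
    and "state_curves H (s(e := Crossing)) = state_curves (ep_penrose e H) s"
proof -
  show "state_curves H (s(e := White)) = state_curves (ep_contract e H) s"
    "state_curves H (s(e := Black)) = state_curves (ep_delete e H) s"
    using state_curves_splice[OF H e] by (simp_all add: ep_contract_def contract_def ep_delete_def delete_def)
  let ?H' = "H\<lparr>model := petrial {e} (model H)\<rparr>"
  have "edge_point_graph ?H'" "e \<in> light ?H'"
    using H e ribbon_graph_petrial by (auto simp: edge_point_graph_def light_def petrial_def)
  then have "state_curves ?H' (s(e := White)) = state_curves (ep_penrose e H) s"
    using state_curves_splice[of ?H' e s White]
    by (simp add: ep_penrose_def penrose_contract_def contract_def)
  then show "state_curves H (s(e := Crossing)) = state_curves (ep_penrose e H) s"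
    using state_curves_petrial[OF H e] by simp
qed

lemma finite_light: "edge_point_graph H \<Longrightarrow> finite (light H)"
  by (simp add: edge_point_graph_def ribbon_graph_def light_def)

text \<open>
  The three terms of the recursion at \<open>e\<close> collect the states by the transition that they choose at \<open>e\<close>.
\<close>

lemma state_sum_recursion:
  fixes x y z t :: "'a::comm_ring_1"
  shows "omega_recursion 0 x y z t (state_sum (case_transition x y z) t :: 'e edge_point \<Rightarrow> 'a)" (is "omega_recursion _ _ _ _ _ ?F")
  unfolding omega_recursion_def
proof (intro allI impI conjI ballI)
  fix H :: "'e edge_point" and e assume H: "edge_point_graph H" and e: "e \<in> light H"
  let ?wt = "case_transition x y z" and ?L = "light H - {e}"
  let ?g = "\<lambda>s. (\<Prod>f \<in> light H. ?wt (s f)) * t ^ state_curves H s"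
  have branch: "(\<Sum>s \<in> ?L \<rightarrow>\<^sub>E UNIV. ?g (s(e := c))) = ?wt c * ?F H'"
    if L: "light H' = ?L" and curves: "\<And>s. state_curves H (s(e := c)) = state_curves H' s" for c H'
  proof -
    have "(\<Prod>f \<in> light H. ?wt ((s(e := c)) f)) = ?wt c * (\<Prod>f \<in> ?L. ?wt (s f))" for s
    proof -
      have "(\<Prod>f \<in> ?L. ?wt ((s(e := c)) f)) = (\<Prod>f \<in> ?L. ?wt (s f))"
        by (rule prod.cong) auto
      then show ?thesis
        unfolding prod.remove[OF finite_light[OF H] e, of "\<lambda>f. ?wt ((s(e := c)) f)"] by simp
    qed
    then show ?thesis
      unfolding state_sum_def L curves sum_distrib_left by (simp add: mult.assoc)
  qed
  have notin: "e \<notin> ?L" by simp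
  have "?F H = sum ?g (insert e ?L \<rightarrow>\<^sub>E UNIV)"
    unfolding state_sum_def insert_Diff[OF e] ..
  also have "\<dots> = ?wt White * ?F (ep_contract e H) + ?wt Black * ?F (ep_delete e H)
      + ?wt Crossing * ?F (ep_penrose e H)"
    unfolding sum_states_insert[OF notin]
      branch[OF edge_point_minors(2)[OF H e] state_curves_minors(1)[OF H e]]
      branch[OF edge_point_minors(4)[OF H e] state_curves_minors(2)[OF H e]]
      branch[OF edge_point_minors(6)[OF H e] state_curves_minors(3)[OF H e]] ..
  finally have "?F H = x * ?F (ep_contract e H) + y * ?F (ep_delete e H) + z * ?F (ep_penrose e H)"
    by simp
  then show "?F H = 0 * ?F (ep_point e H) + x * ?F (ep_contract e H)
      + y * ?F (ep_delete e H) + z * ?F (ep_penrose e H)"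
    by simp
next
  fix H :: "'e edge_point" assume H: "edge_point_graph H" and L: "light H = {}"
  then have "dark H = edges (model H)" by (auto simp: edge_point_graph_def light_def)
  then show "?F H = t ^ num_components (model H)"
    using L by (simp add: state_sum_def state_curves_def state_joins_def num_components_def components_def)
qed

text \<open>
  With \<open>w = 0\<close> only minors with fewer light edges matter, and they are edge-point graphs again.
\<close>

lemma omega_recursion_unique:
  assumes F: "omega_recursion 0 x y z t F" and F': "omega_recursion 0 x y z t F'"
    and "edge_point_graph H"
  shows "F H = F' H"
  using assms(3)
proof (induction "card (light H)" arbitrary: H rule: less_induct)
  case less
  show ?case
  proof (cases "light H = {}")
    case True
    then show ?thesis using F F' less.prems by (simp add: omega_recursion_def)
  next
    case False
    then obtain e where e: "e \<in> light H" by blast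
    have "card (light H - {e}) < card (light H)"
      using e finite_light[OF less.prems] by (rule card_Diff1_less[rotated])
    then have IH: "F H' = F' H'" if "edge_point_graph H'" "light H' = light H - {e}" for H'
      using less.hyps that by simp
    have "F H = x * F (ep_contract e H) + y * F (ep_delete e H) + z * F (ep_penrose e H)"
      using F less.prems e by (simp add: omega_recursion_def)
    moreover have "F' H = x * F' (ep_contract e H) + y * F' (ep_delete e H) + z * F' (ep_penrose e H)"
      using F' less.prems e by (simp add: omega_recursion_def)
    ultimately show ?thesis
      using IH edge_point_minors[OF less.prems e] by simp
  qed
qed

lemma Omega_state_sum:
  assumes "edge_point_graph H"
  shows "Omega H 0 x y z t = state_sum (case_transition x y z) t H"
proof -
  have "omega_recursion 0 x y z t (SOME F. omega_recursion 0 x y z t F)"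
    by (rule someI[of "omega_recursion 0 x y z t", OF state_sum_recursion])
  then show ?thesis
    unfolding Omega_def by (rule omega_recursion_unique[OF _ state_sum_recursion assms])
qed

lemma Omega_of_ribbon:
  fixes G :: "'e ribbon"
  assumes "ribbon_graph G"
  shows "Omega (of_ribbon G) 0 x y z t
    = (\<Sum>s \<in> edges G \<rightarrow>\<^sub>E UNIV. (\<Prod>e \<in> edges G. case_transition x y z (s e))
        * t ^ (num_classes (corners (edges G)) (state_joins (edges G) s \<union> arcs G) + isolated G))"
proof -
  have "edge_point_graph (of_ribbon G)"
    using assms by (simp add: edge_point_graph_def of_ribbon_def)
  then show ?thesis
    using join_empty[of Black, where ?'a = 'e] join_empty[of White, where ?'a = 'e]
    by (simp add: Omega_state_sum state_sum_def state_curves_def light_def of_ribbon_def)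
qed

text \<open>
  When one transition has weight zero, a state is given by the set of edges on which the first
  of the other two is chosen.
\<close>

lemma Omega_subsets:
  assumes G: "ribbon_graph G" and wt: "wt = case_transition x y z"
    and cd: "c \<noteq> d" and zero: "\<And>b. b \<noteq> c \<Longrightarrow> b \<noteq> d \<Longrightarrow> wt b = 0"
  shows "Omega (of_ribbon G) 0 x y z t
    = (\<Sum>A \<in> Pow (edges G). wt c ^ card A * wt d ^ card (edges G - A)
        * t ^ (num_classes (corners (edges G)) (join c A \<union> join d (edges G - A) \<union> arcs G)
               + isolated G))"
proof -
  let ?E = "edges G"
  let ?g = "\<lambda>s. (\<Prod>e \<in> ?E. wt (s e))
    * t ^ (num_classes (corners ?E) (state_joins ?E s \<union> arcs G) + isolated G)"
  let ?S = "?E \<rightarrow>\<^sub>E {c, d}"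
  let ?st = "\<lambda>A. \<lambda>e \<in> ?E. if e \<in> A then c else d"
  have fin: "finite ?E" using G by (simp add: ribbon_graph_def)
  have fin_states: "finite (?E \<rightarrow>\<^sub>E (UNIV :: transition set))"
  proof (rule finite_PiE[OF fin])
    show "finite (UNIV :: transition set)" unfolding UNIV_transition by simp
  qed
  have "Omega (of_ribbon G) 0 x y z t = sum ?g (?E \<rightarrow>\<^sub>E UNIV)"
    unfolding wt by (rule Omega_of_ribbon[OF G])
  also have "\<dots> = sum ?g ?S"
  proof (rule sum.mono_neutral_right[OF fin_states])
    show "?S \<subseteq> ?E \<rightarrow>\<^sub>E UNIV" by (rule PiE_mono) simp
    show "\<forall>s \<in> (?E \<rightarrow>\<^sub>E UNIV) - ?S. ?g s = 0"
    proof
      fix s assume "s \<in> (?E \<rightarrow>\<^sub>E UNIV) - ?S"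
      then obtain e where e: "e \<in> ?E" "s e \<noteq> c" "s e \<noteq> d" by (auto simp: PiE_iff)
      then have "(\<Prod>e \<in> ?E. wt (s e)) = 0" by (intro prod_zero[OF fin] bexI[of _ e] zero)
      then show "?g s = 0" by simp
    qed
  qed
  also have "\<dots> = (\<Sum>A \<in> Pow ?E. ?g (?st A))"
  proof (rule sum.reindex_bij_witness[of _ ?st "\<lambda>s. {e \<in> ?E. s e = c}"])
    fix s assume s: "s \<in> ?S"
    then show "?st {e \<in> ?E. s e = c} = s"
      by (intro ext) (auto simp: PiE_iff extensional_def)
    then show "?g (?st {e \<in> ?E. s e = c}) = ?g s" by simp
  qed (use cd in auto)
  also have "\<dots> = (\<Sum>A \<in> Pow ?E. wt c ^ card A * wt d ^ card (?E - A)
      * t ^ (num_classes (corners ?E) (join c A \<union> join d (?E - A) \<union> arcs G) + isolated G))"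
  proof (rule sum.cong[OF refl])
    fix A assume "A \<in> Pow ?E"
    then have A: "A \<subseteq> ?E" by simp
    have "(\<Prod>e \<in> ?E. wt (?st A e)) = (\<Prod>e \<in> ?E - A. wt (?st A e)) * (\<Prod>e \<in> A. wt (?st A e))"
      by (rule prod.subset_diff[OF A fin])
    also have "(\<Prod>e \<in> ?E - A. wt (?st A e)) = (\<Prod>e \<in> ?E - A. wt d)"
      by (rule prod.cong) auto
    also have "(\<Prod>e \<in> A. wt (?st A e)) = (\<Prod>e \<in> A. wt c)"
      using A by (intro prod.cong) auto
    finally have "(\<Prod>e \<in> ?E. wt (?st A e)) = wt c ^ card A * wt d ^ card (?E - A)"
      by (simp add: mult.commute)
    then show "?g (?st A) = wt c ^ card A * wt d ^ card (?E - A)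
      * t ^ (num_classes (corners ?E) (join c A \<union> join d (?E - A) \<union> arcs G) + isolated G)"
      unfolding state_joins_two[OF A] by simp
  qed
  finally show ?thesis .
qed


section \<open>Rank, nullity and Euler genus of spanning subgraphs\<close>

lemma edges_spanning_subgraph: "A \<subseteq> edges G \<Longrightarrow> edges (spanning_subgraph G A) = A"
  by (auto simp: spanning_subgraph_def delete_def edges_splice)

lemma num_classes_spanning_subgraph:
  assumes "ribbon_graph G" "A \<subseteq> edges G" "R \<subseteq> corners A \<times> corners A" "sym R"
  shows "num_classes (corners A) (R \<union> arcs (spanning_subgraph G A))
      + isolated (spanning_subgraph G A)
    = num_classes (corners (edges G)) (R \<union> ends (edges G - A) \<union> arcs G) + isolated G"
proof -
  let ?B = "edges G - A"
  have B: "edges G - ?B = A" using assms(2) by blast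
  have "edges (splice (ends ?B) ?B G) = A" by (simp only: edges_splice B)
  then show ?thesis
    using num_classes_splice_ribbon[OF assms(1) Diff_subset ends_matching, of R A, unfolded B, OF assms(3,4)]
    by (simp only: spanning_subgraph_def delete_def)
qed

text \<open>
  The statistics of a spanning subgraph are read off on the corners of the whole graph, with the
  vertex boundaries continued along the ends of the deleted edges. For a fixed set of corners, different
  subgraphs can then be compared by inclusion of the generating relations.
\<close>

lemma bdry_eq:
  assumes "ribbon_graph G" "A \<subseteq> edges G"
  shows "bdry G A
    = num_classes (corners (edges G)) (sides A \<union> ends (edges G - A) \<union> arcs G) + isolated G"
  using num_classes_spanning_subgraph[OF assms matching_subset matching_sym, OF sides_matching sides_matching]
  by (simp only: bdry_def num_boundaries_def boundaries_def edges_spanning_subgraph[OF assms(2)])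

lemma kappa_eq:
  assumes "ribbon_graph G" "A \<subseteq> edges G"
  shows "kappa G A
    = num_classes (corners (edges G)) (ends (edges G) \<union> sides A \<union> arcs G) + isolated G"
proof -
  let ?B = "edges G - A"
  have R: "ends A \<union> sides A \<subseteq> corners A \<times> corners A" "sym (ends A \<union> sides A)"
    by (intro Un_least sym_Un matching_subset[OF ends_matching] matching_subset[OF sides_matching]
        matching_sym[OF ends_matching] matching_sym[OF sides_matching])+
  have "A \<union> ?B = edges G" using assms(2) by blast
  then have "ends A \<union> sides A \<union> ends ?B = ends (edges G) \<union> sides A"
    using join_Un[of Black A ?B] by auto
  then show ?thesis
    using num_classes_spanning_subgraph[OF assms R]
    by (simp only: kappa_def num_components_def components_def edges_spanning_subgraph[OF assms(2)])
qed

lemma sides_empty: "sides {} = {}" and ends_empty: "ends {} = {}"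
  by (simp_all add: sides_def ends_def)

lemma kappa_extremes:
  assumes "ribbon_graph G"
  shows "kappa G {} = num_vertices G" "kappa G (edges G) = num_components G"
  using kappa_eq[OF assms]
  by (simp_all add: sides_empty num_vertices_def vertices_def num_components_def components_def)

lemma bdry_extremes:
  assumes "ribbon_graph G"
  shows "bdry G {} = num_vertices G" "bdry G (edges G) = num_boundaries G"
  using bdry_eq[OF assms]
  by (simp_all add: sides_empty ends_empty num_vertices_def vertices_def num_boundaries_def
      boundaries_def)

text \<open>
  Twice the number of components minus the Euler characteristic of the capped surface, for the spanning
  subgraph on \<open>A\<close>.
\<close>

definition euler_genus :: "'e ribbon \<Rightarrow> 'e set \<Rightarrow> int" where
  "euler_genus G A = 2 * int (kappa G A) - int (num_vertices G) + int (card A) - int (bdry G A)"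

context
  fixes G :: "'e ribbon"
  assumes G: "ribbon_graph G"
begin

lemma finite_edges: "finite (edges G)"
  using G by (simp add: ribbon_graph_def)

lemma sym_arcs: "sym (arcs G)"
  using G by (simp add: ribbon_graph_def)

lemma kappa_antimono:
  assumes "A \<subseteq> B" "B \<subseteq> edges G"
  shows "kappa G B \<le> kappa G A"
proof -
  have "sides A \<subseteq> sides B" using assms(1) by (auto simp: sides_def)
  then have "(ends (edges G) \<union> sides A \<union> arcs G)\<^sup>* \<subseteq> (ends (edges G) \<union> sides B \<union> arcs G)\<^sup>*"
    by (intro rtrancl_mono) auto
  moreover have "sym (ends (edges G) \<union> sides B \<union> arcs G)"
    by (intro sym_Un sym_arcs matching_sym[OF ends_matching] matching_sym[OF sides_matching])
  moreover have "A \<subseteq> edges G" using assms by blast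
  ultimately show ?thesis
    using num_classes_antimono[OF finite_corners[OF finite_edges]] assms(2)
    by (simp add: kappa_eq[OF G])
qed

text \<open>
  The two corners on an end of \<open>e\<close> lie on the same vertex. So the two sides of \<open>e\<close> join the same two
  components, and together they lower the number of components by at most one.
\<close>

lemma kappa_insert:
  assumes "e \<in> edges G" "A \<subseteq> edges G"
  shows "kappa G A \<le> Suc (kappa G (insert e A))"
proof -
  let ?r = "ends (edges G) \<union> sides A \<union> arcs G"
  let ?U = "?r\<^sup>* `` {(e, False, False)} \<union> ?r\<^sup>* `` {(e, True, False)}"
  have "((e, i, s), (e, i, \<not> s)) \<in> ?r" for i s
    using assms(1) by (simp add: join_iff)
  from this[of _ False] have "((e, i, False), (e, i, s)) \<in> ?r\<^sup>*" for i s
    by (cases s) (simp_all only: not_False_eq_True rtrancl.rtrancl_refl r_into_rtrancl)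
  then have "(e, i, s) \<in> ?U" for i s
    by (cases i) (simp_all only: Un_iff Image_singleton_iff simp_thms)
  then have "sides {e} \<subseteq> ?U \<times> ?U" unfolding sides_def by blast
  moreover have "sym ?r"
    by (intro sym_Un sym_arcs matching_sym[OF ends_matching] matching_sym[OF sides_matching])
  ultimately have "num_classes (corners (edges G)) ?r
      \<le> Suc (num_classes (corners (edges G)) (?r \<union> sides {e}))"
    using num_classes_le_Suc[OF finite_corners[OF finite_edges] _ matching_sym[OF sides_matching]]
    by blast
  moreover have "?r \<union> sides {e} = ends (edges G) \<union> sides (insert e A) \<union> arcs G"
    by (auto simp: sides_def)
  ultimately show ?thesis
    using assms by (simp add: kappa_eq[OF G])
qed

lemma rank_le_card:
  assumes "A \<subseteq> edges G"
  shows "num_vertices G \<le> kappa G A + card A"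
proof -
  have "finite A" using assms finite_edges by (rule finite_subset)
  then show ?thesis
    using assms
  proof induction
    case empty
    then show ?case by (simp add: kappa_extremes[OF G])
  next
    case (insert e A)
    then show ?case using kappa_insert[of e A] by simp
  qed
qed

text \<open>
  The defining equations of rank and nullity, freed from the subtraction of natural numbers.
\<close>

lemma rank_nullity:
  assumes "A \<subseteq> edges G"
  shows "num_components G + (rank G (edges G) - rank G A) = kappa G A"
    and "nullity G A + num_vertices G = card A + kappa G A"
proof -
  have "num_components G \<le> kappa G A" "kappa G A \<le> num_vertices G"
    using kappa_antimono[OF empty_subsetI assms] kappa_antimono[OF assms subset_refl]
    by (simp_all only: kappa_extremes[OF G])
  then show "num_components G + (rank G (edges G) - rank G A) = kappa G A"
    and "nullity G A + num_vertices G = card A + kappa G A"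
    using rank_le_card[OF assms] unfolding rank_def nullity_def kappa_extremes[OF G] by linarith+
qed

lemma genus_nullity:
  assumes "A \<subseteq> edges G"
  shows "int (kappa G A) - int (bdry G A) + int (nullity G A) = euler_genus G A"
  using rank_nullity(2)[OF assms] by (simp add: euler_genus_def)

text \<open>
  Adding an edge \<open>e\<close> changes the number of boundary components by at most one, because both numbers
  exceed by at most one the number that is left when all four corners of \<open>e\<close> are
  identified. That suffices unless \<open>e\<close> connects two components. In this case a boundary arc that
  starts at a corner of \<open>e\<close> must return to the same end of \<open>e\<close>, since the other end lies in another
  component. Therefore \<open>e\<close> merges two boundary components, just as it merges two components.
\<close>

lemma euler_genus_insert:
  assumes e: "e \<in> edges G" and A: "A \<subseteq> edges G" and eA: "e \<notin> A"
  shows "euler_genus G A \<le> euler_genus G (insert e A)"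
proof -
  let ?C = "corners (edges G)"
  let ?B = "edges G - {e}"
  \<comment> \<open>\<open>R\<close> leaves open how the four corners of \<open>e\<close> are joined: along its ends they give the boundary
    for \<open>A\<close>, along its sides the boundary for \<open>insert e A\<close>.\<close>
  define \<rho> where "\<rho> = sides A \<union> ends (edges G - insert e A)"
  define R where "R = \<rho> \<union> arcs G"
  define K where "K = ends (edges G) \<union> sides A \<union> arcs G"
  define N where "N = num_classes ?C (R \<union> sides {e} \<union> ends {e})"
  have fin: "finite ?C" by (rule finite_corners[OF finite_edges])
  have syms: "sym R" "sym (ends {e})" "sym (sides {e})" "sym K"
    unfolding R_def \<rho>_def K_def
    by (intro sym_Un sym_arcs matching_sym[OF ends_matching] matching_sym[OF sides_matching])+
  have b_A: "bdry G A = num_classes ?C (R \<union> ends {e}) + isolated G"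
  proof -
    have "ends (edges G - A) = ends (edges G - insert e A) \<union> ends {e}"
      using e eA by (auto simp: ends_def)
    then have "sides A \<union> ends (edges G - A) \<union> arcs G = R \<union> ends {e}"
      by (auto simp: R_def \<rho>_def)
    then show ?thesis using bdry_eq[OF G A] by simp
  qed
  have b_eA: "bdry G (insert e A) = num_classes ?C (R \<union> sides {e}) + isolated G"
  proof -
    have "sides (insert e A) \<union> ends (edges G - insert e A) \<union> arcs G = R \<union> sides {e}"
      by (auto simp: R_def \<rho>_def sides_def)
    then show ?thesis using bdry_eq[OF G, of "insert e A"] e A by simp
  qed
  have N_le: "N \<le> num_classes ?C (R \<union> ends {e})"
    unfolding N_def
    by (intro num_classes_antimono[OF fin] sym_Un syms rtrancl_mono) auto
  have eA_le: "num_classes ?C (R \<union> sides {e}) \<le> Suc N"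
  proof -
    let ?r = "R \<union> sides {e}"
    let ?U = "?r\<^sup>* `` {(e, False, False)} \<union> ?r\<^sup>* `` {(e, False, True)}"
    have "((e, i, s), (e, \<not> i, s)) \<in> ?r" for i s
      by (simp add: join_iff)
    from this[of False] have "((e, False, s), (e, i, s)) \<in> ?r\<^sup>*" for i s
      by (cases i) (simp_all only: not_False_eq_True rtrancl.rtrancl_refl r_into_rtrancl)
    then have "(e, i, s) \<in> ?U" for i s
      by (cases s) (simp_all only: Un_iff Image_singleton_iff simp_thms)
    then have "ends {e} \<subseteq> ?U \<times> ?U" unfolding ends_def by blast
    then show ?thesis
      unfolding N_def using num_classes_le_Suc[OF fin sym_Un[OF syms(1,3)] syms(2)] by blast
  qed
  have card: "card (insert e A) = Suc (card A)"
    using eA A finite_edges by (simp add: finite_subset)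
  show ?thesis
  proof (cases "kappa G A \<le> kappa G (insert e A)")
    case True
    then show ?thesis
      using N_le eA_le b_A b_eA card by (simp add: euler_genus_def)
  next
    case False
    have K_end: "((e, i, s), (e, i, s')) \<in> K\<^sup>*" for i s s'
    proof (cases "s = s'")
      case neq: False
      then have "s' = (\<not> s)" by simp
      then have "((e, i, s), (e, i, s')) \<in> K" using e by (simp add: K_def join_iff)
      then show ?thesis by simp
    qed simp
    have apart: "((e, i, s), (e, \<not> i, s')) \<notin> K\<^sup>*" for i s s'
    proof
      assume "((e, i, s), (e, \<not> i, s')) \<in> K\<^sup>*"
      then have *: "((e, i, u), (e, \<not> i, u)) \<in> K\<^sup>*" for u
        by (rule rtrancl_trans[OF rtrancl_trans[OF K_end] K_end])
      moreover have "((e, \<not> i, u), (e, i, u)) \<in> K\<^sup>*" for u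
        by (rule symD[OF sym_rtrancl[OF syms(4)] *])
      ultimately have "((e, j, u), (e, \<not> j, u)) \<in> K\<^sup>*" for j u
        by (cases j; cases i) (simp_all only: not_True_eq_False not_False_eq_True)
      then have "sides {e} \<subseteq> K\<^sup>*" unfolding sides_def by blast
      moreover have "K \<subseteq> K\<^sup>*" by auto
      ultimately have "(K \<union> sides {e})\<^sup>* \<subseteq> K\<^sup>*"
        by (intro rtrancl_subset_rtrancl Un_least)
      then have "num_classes ?C K \<le> num_classes ?C (K \<union> sides {e})"
        by (intro num_classes_antimono[OF fin syms(4)])
      moreover have "K \<union> sides {e} = ends (edges G) \<union> sides (insert e A) \<union> arcs G"
        by (auto simp: K_def sides_def)
      ultimately show False
        using False kappa_eq[OF G, of "insert e A"] kappa_eq[OF G A] e A by (simp add: K_def)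
    qed
    have "R \<union> ends {e} \<subseteq> K"
      using e by (auto simp: R_def \<rho>_def K_def ends_def)
    then have RK: "R\<^sup>* \<subseteq> K\<^sup>*" "(R \<union> ends {e})\<^sup>* \<subseteq> K\<^sup>*"
      by (simp_all add: rtrancl_mono)
    have "N < num_classes ?C (R \<union> ends {e})"
      unfolding N_def
    proof (rule num_classes_strict_antimono[OF fin])
      show "sym (R \<union> ends {e})" "sym (R \<union> sides {e} \<union> ends {e})"
        by (intro sym_Un syms)+
      show "(R \<union> ends {e})\<^sup>* \<subseteq> (R \<union> sides {e} \<union> ends {e})\<^sup>*" by (intro rtrancl_mono) auto
      show "(e, False, False) \<in> ?C" "(e, True, False) \<in> ?C"
        using e by (simp_all add: corners_iff)
      show "((e, False, False), (e, True, False)) \<in> (R \<union> sides {e} \<union> ends {e})\<^sup>*"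
        by (intro r_into_rtrancl) (simp add: join_iff)
      show "((e, False, False), (e, True, False)) \<notin> (R \<union> ends {e})\<^sup>*"
        using apart[of False False False] RK(2) by (simp only: not_False_eq_True) blast
    qed
    moreover have "num_classes ?C (R \<union> sides {e}) \<le> N"
    proof -
      have \<rho>: "perfect_matching (corners ?B) \<rho>"
      proof -
        have "corners ?B = corners A \<union> corners (edges G - insert e A)"
          using A eA by (auto simp: corners_iff)
        moreover have "corners A \<inter> corners (edges G - insert e A) = {}"
          by (auto simp: corners_iff)
        ultimately show ?thesis
          unfolding \<rho>_def using matching_Un[OF sides_matching ends_matching] by metis
      qed
      \<comment> \<open>Splicing out all edges but \<open>e\<close> yields a perfect matching of the corners of \<open>e\<close>.\<close>
      have "((e, i, s), (e, i, \<not> s)) \<in> R\<^sup>*" for i s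
      proof -
        have "(e, i, s) \<in> corners (edges G - ?B)" using e by (simp add: corners_iff)
        then obtain d where d: "d \<in> corners (edges G - ?B)" "d \<noteq> (e, i, s)" "((e, i, s), d) \<in> R\<^sup>*"
          unfolding R_def by (rule splice_partner[OF G Diff_subset \<rho>])
        then obtain j u where "d = (e, j, u)" by (cases d) (auto simp: corners_iff)
        moreover have "j = i"
        proof (rule ccontr)
          assume "j \<noteq> i"
          then have "j = (\<not> i)" by simp
          then show False using apart[of i s u] d(3) RK(1) \<open>d = (e, j, u)\<close> by blast
        qed
        ultimately have "d = (e, i, \<not> s)" using d(2) by simp
        then show ?thesis using d(3) by simp
      qed
      then have "ends {e} \<subseteq> R\<^sup>*" unfolding ends_def by blast
      moreover have "R\<^sup>* \<subseteq> (R \<union> sides {e})\<^sup>*" by (intro rtrancl_mono) auto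
      ultimately have "(R \<union> sides {e} \<union> ends {e})\<^sup>* \<subseteq> (R \<union> sides {e})\<^sup>*"
        by (intro rtrancl_subset_rtrancl Un_least) blast+
      then show ?thesis
        unfolding N_def by (intro num_classes_antimono[OF fin] sym_Un syms)
    qed
    ultimately show ?thesis
      using b_A b_eA card kappa_insert[OF e A] by (simp add: euler_genus_def)
  qed
qed

lemma euler_genus_mono:
  assumes "A \<union> D \<subseteq> edges G"
  shows "euler_genus G A \<le> euler_genus G (A \<union> D)"
proof -
  have "finite D" using assms finite_edges by (auto intro: finite_subset)
  then show ?thesis
    using assms
  proof induction
    case (insert e D)
    then have IH: "euler_genus G A \<le> euler_genus G (A \<union> D)" by simp
    show ?case
    proof (cases "e \<in> A \<union> D")
      case True
      then have "A \<union> insert e D = A \<union> D" by blast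
      then show ?thesis using IH by simp
    next
      case False
      then show ?thesis
        using IH euler_genus_insert[of e "A \<union> D"] insert.prems by simp
    qed
  qed simp
qed

lemma euler_genus_empty: "euler_genus G {} = 0"
  by (simp add: euler_genus_def kappa_extremes[OF G] bdry_extremes[OF G])

lemma class_in_unique_component:
  assumes "c \<in> S" "c \<in> corners (edges G)"
    and "\<And>d. d \<in> S \<Longrightarrow> (c, d) \<in> (ends (edges G) \<union> sides (edges G) \<union> arcs G)\<^sup>*"
  shows "\<exists>!K. K \<in> components G \<and> S \<subseteq> K"
proof -
  let ?k = "ends (edges G) \<union> sides (edges G) \<union> arcs G"
  have k: "sym ?k"
    by (intro sym_Un sym_arcs matching_sym[OF ends_matching] matching_sym[OF sides_matching])
  show ?thesis
  proof (rule ex1I[of _ "?k\<^sup>* `` {c}"])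
    show "?k\<^sup>* `` {c} \<in> components G \<and> S \<subseteq> ?k\<^sup>* `` {c}"
      unfolding components_def using assms by (auto intro: quotientI)
    fix K assume K: "K \<in> components G \<and> S \<subseteq> K"
    then obtain d where "K = ?k\<^sup>* `` {d}" unfolding components_def by (auto elim: quotientE)
    then show "K = ?k\<^sup>* `` {c}" using K assms(1) rtrancl_Image_eq[OF k] by blast
  qed
qed

text \<open>
  Each vertex, edge and boundary component lies in exactly one component, so the Euler
  characteristics of the capped components add up.
\<close>

lemma euler_genus_plane:
  assumes "plane G"
  shows "euler_genus G (edges G) = 0"
proof -
  let ?C = "corners (edges G)" and ?k = "ends (edges G) \<union> sides (edges G) \<union> arcs G"
  have fin: "finite (components G)" "finite (vertices G)" "finite (boundaries G)"
    unfolding components_def vertices_def boundaries_def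
    by (intro finite_classes finite_corners finite_edges)+
  have in_one: "\<exists>!K. K \<in> components G \<and> v \<subseteq> K" if "v \<in> ?C // r\<^sup>*" "r \<subseteq> ?k" for v r
  proof -
    from that(1) obtain c where "v = r\<^sup>* `` {c}" "c \<in> ?C" by (rule quotientE)
    moreover have "(c, d) \<in> ?k\<^sup>*" if "d \<in> r\<^sup>* `` {c}" for d
      using that rtrancl_mono[OF \<open>r \<subseteq> ?k\<close>] by blast
    ultimately show ?thesis
      by (intro class_in_unique_component[of c v]) auto
  qed
  have v: "card (vertices G) = (\<Sum>K \<in> components G. card {v \<in> vertices G. v \<subseteq> K})"
    using fin(2,1)
  proof (rule card_eq_sum_blocks)
    fix v assume "v \<in> vertices G"
    then show "\<exists>!K. K \<in> components G \<and> v \<subseteq> K"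
      unfolding vertices_def by (rule in_one) blast
  qed
  have b: "card (boundaries G) = (\<Sum>K \<in> components G. card {b \<in> boundaries G. b \<subseteq> K})"
    using fin(3,1)
  proof (rule card_eq_sum_blocks)
    fix b assume "b \<in> boundaries G"
    then show "\<exists>!K. K \<in> components G \<and> b \<subseteq> K"
      unfolding boundaries_def by (rule in_one) blast
  qed
  have e: "card (edges G) = (\<Sum>K \<in> components G. card {e \<in> edges G. corners {e} \<subseteq> K})"
  proof (rule card_eq_sum_blocks[OF finite_edges fin(1)])
    fix e assume e: "e \<in> edges G"
    have connected: "((e, False, False), (e, i, s)) \<in> ?k\<^sup>*" for i s
    proof -
      have "((e, False, False), (e, i, False)) \<in> ?k\<^sup>*"
        using e by (cases i) (auto simp: join_iff intro!: r_into_rtrancl)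
      moreover have "((e, i, False), (e, i, s)) \<in> ?k\<^sup>*"
        using e by (cases s) (auto simp: join_iff intro!: r_into_rtrancl)
      ultimately show ?thesis by (rule rtrancl_trans)
    qed
    show "\<exists>!K. K \<in> components G \<and> corners {e} \<subseteq> K"
    proof (rule class_in_unique_component)
      show "(e, False, False) \<in> corners {e}" "(e, False, False) \<in> ?C"
        using e by (simp_all add: corners_iff)
      show "((e, False, False), d) \<in> ?k\<^sup>*" if "d \<in> corners {e}" for d
        using that connected by (cases d) (simp add: corners_iff)
    qed
  qed
  have "int (card (vertices G)) - int (card (edges G)) + int (card (boundaries G))
      = (\<Sum>K \<in> components G. capped_euler_char G K)"
    unfolding capped_euler_char_def v b e by (simp add: sum.distrib sum_subtractf)
  also have "\<dots> = 2 * int (card (components G))"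
    using assms by (simp add: plane_def)
  finally show ?thesis
    by (simp add: euler_genus_def kappa_extremes[OF G] bdry_extremes[OF G] num_vertices_def
        num_boundaries_def num_components_def)
qed

lemma euler_genus_subgraph_of_plane:
  assumes "plane G" "A \<subseteq> edges G"
  shows "euler_genus G A = 0"
proof -
  have E: "A \<union> edges G = edges G" using assms(2) by blast
  have "euler_genus G {} \<le> euler_genus G A"
    using euler_genus_mono[of "{}" A] assms(2) by (simp only: Un_empty_left)
  moreover have "euler_genus G A \<le> euler_genus G (edges G)"
    using euler_genus_mono[of A "edges G"] by (simp only: E subset_refl)
  ultimately show ?thesis
    using euler_genus_empty euler_genus_plane[OF assms(1)] by linarith
qed

end

section \<open>Specialisations of the state sum\<close>

text \<open>
  The partial Petrial for \<open>A\<close> keeps the arcs of \<open>G\<close> if the sides of the edges of \<open>A\<close> are replaced by their diagonals, so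
  its boundary components are the curves of the state with crossings on \<open>A\<close>.
\<close>

lemma Omega_eq_penrose:
  fixes l :: "'a::comm_ring_1"
  assumes G: "ribbon_graph G"
  shows "Omega (of_ribbon G) 0 1 0 (- 1) l = penrose G l"
proof -
  have "num_boundaries (petrial A G)
      = num_classes (corners (edges G)) (crossings A \<union> sides (edges G - A) \<union> arcs G) + isolated G"
    if "A \<subseteq> edges G" for A
  proof -
    have "A \<union> (edges G - A) = edges G" using that by blast
    then have "sides (edges G) = sides A \<union> sides (edges G - A)"
      using join_Un[of White A "edges G - A"] by simp
    moreover have "retwist A (sides (edges G - A)) = sides (edges G - A)"
      by (rule retwist_disjoint[OF matching_subset[OF sides_matching]]) auto
    ultimately have "retwist A (sides (edges G)) = crossings A \<union> sides (edges G - A)"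
      using retwist_joins(2)[of A] by (simp add: image_Un)
    then show ?thesis
      using num_classes_petrial[of G "sides (edges G)" A]
      by (simp add: num_boundaries_def boundaries_def petrial_def)
  qed
  moreover have "case_transition 1 0 (- 1) b = (0 :: 'a)" if "b \<noteq> Crossing" "b \<noteq> White" for b
    using that by (cases b) simp_all
  ultimately show ?thesis
    using Omega_subsets[OF G refl, of Crossing White 1 0 "- 1" l]
    by (simp add: penrose_def)
qed

text \<open>
  The summands agree one by one. For a spanning subgraph with \<open>m\<close> edges, \<open>v\<close> vertices, \<open>k\<close> components, \<open>f\<close> boundary components
  and nullity \<open>n\<close>, the relation \<open>n + v = m + k\<close> makes both sides equal to \<open>p powi (f - m) * q powi (f + m)\<close>.
\<close>

lemma Omega_eq_bollobas_riordan:
  fixes p q :: "'a::field"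
  assumes G: "ribbon_graph G" and pq: "p \<noteq> 0" "q \<noteq> 0"
  shows "Omega (of_ribbon G) 0 (q / p) 1 0 (p * q)
    = (p ^ 2) ^ num_components G * (q / p) ^ num_vertices G
      * bollobas_riordan G (p ^ 2 + 1) (q ^ 2) (1 / (p * q))"
proof -
  let ?E = "edges G" and ?v = "num_vertices G"
  have summand: "(q / p) ^ card A * (p * q) ^ bdry G A
      = (p ^ 2) ^ num_components G * (q / p) ^ ?v
        * ((p ^ 2) ^ (rank G ?E - rank G A) * (q ^ 2) ^ nullity G A
           * (1 / (p * q)) powi (int (kappa G A) - int (bdry G A) + int (nullity G A)))"
    if A: "A \<subseteq> ?E" for A
  proof -
    let ?m = "card A" and ?f = "bdry G A" and ?k = "kappa G A" and ?n = "nullity G A"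
    note nullity = rank_nullity(2)[OF G A]
    have "(p ^ 2) ^ num_components G * (p ^ 2) ^ (rank G ?E - rank G A) = (p ^ 2) ^ ?k"
      using rank_nullity(1)[OF G A] by (simp add: power_add[symmetric])
    moreover have "(1 / (p * q)) powi (int ?k - int ?f + int ?n) = (p * q) ^ ?f / (p * q) ^ (?k + ?n)"
    proof -
      have "(1 / (p * q)) powi (int ?k - int ?f + int ?n) = (p * q) powi - (int ?k - int ?f + int ?n)"
        by (simp only: power_int_inverse power_int_minus inverse_eq_divide[symmetric])
      also have "\<dots> = (p * q) powi (int ?f - int (?k + ?n))" by (simp add: algebra_simps)
      also have "\<dots> = (p * q) ^ ?f / (p * q) ^ (?k + ?n)"
        using power_int_diff[of "p * q" "int ?f" "int (?k + ?n)"] pq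
        by (simp only: power_int_of_nat mult_eq_0_iff simp_thms)
      finally show ?thesis .
    qed
    moreover have "(q / p) ^ ?m * (p * q) ^ (?k + ?n) = (p ^ 2) ^ ?k * (q / p) ^ ?v * (q ^ 2) ^ ?n"
    proof -
      have "(q ^ ?m * (p * q) ^ (?k + ?n)) * p ^ ?v = q ^ (?m + ?k + ?n) * p ^ (?k + ?n + ?v)"
        by (simp add: power_add power_mult_distrib mult_ac)
      also have "?m + ?k + ?n = 2 * ?n + ?v" using nullity by simp
      also have "?k + ?n + ?v = 2 * ?k + ?m" using nullity by simp
      also have "q ^ (2 * ?n + ?v) * p ^ (2 * ?k + ?m) = ((p ^ 2) ^ ?k * q ^ ?v * (q ^ 2) ^ ?n) * p ^ ?m"
        by (simp only: power_add power_mult) (simp only: mult_ac)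
      finally have "(q ^ ?m * (p * q) ^ (?k + ?n)) * p ^ ?v
        = ((p ^ 2) ^ ?k * q ^ ?v * (q ^ 2) ^ ?n) * p ^ ?m" .
      then show ?thesis using pq by (simp add: power_divide field_simps)
    qed
    ultimately show ?thesis
      using pq by (simp add: field_simps)
  qed
  have "case_transition (q / p) 1 0 b = 0" if "b \<noteq> White" "b \<noteq> Black" for b
    using that by (cases b) simp_all
  then have "Omega (of_ribbon G) 0 (q / p) 1 0 (p * q)
      = (\<Sum>A \<in> Pow ?E. (q / p) ^ card A * (p * q) ^ bdry G A)"
    using Omega_subsets[OF G refl, of White Black "q / p" 1 0 "p * q"] bdry_eq[OF G]
    by simp
  also have "\<dots> = (p ^ 2) ^ num_components G * (q / p) ^ ?v
      * bollobas_riordan G (p ^ 2 + 1) (q ^ 2) (1 / (p * q))"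
    unfolding bollobas_riordan_def sum_distrib_left by (intro sum.cong refl) (simp add: summand)
  finally show ?thesis .
qed

lemma bollobas_riordan_plane:
  assumes G: "ribbon_graph G" and "plane G"
  shows "bollobas_riordan G x y z = tutte G x (y + 1)"
  unfolding bollobas_riordan_def tutte_def
  using genus_nullity[OF G] euler_genus_subgraph_of_plane[OF G assms(2)]
  by (intro sum.cong refl) simp

lemma joins_medial: "joins (medial G) e c = join c {e}"
proof (cases c)
  case White
  then show ?thesis
    by (auto simp: medial_def sides_def doubleton_eq_iff)
next
  case Black
  then show ?thesis
    by (auto simp: medial_def ends_def doubleton_eq_iff)
next
  case Crossing
  then show ?thesis
    by (auto simp: medial_def crossings_def corners_def doubleton_eq_iff)
qed

lemma Omega_eq_transition_poly:
  assumes G: "ribbon_graph G"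
  shows "Omega (of_ribbon G) 0 \<alpha> \<beta> \<gamma> t = transition_poly G (\<alpha>, \<beta>, \<gamma>) t"
proof -
  let ?E = "edges G" and ?wt = "case_transition \<alpha> \<beta> \<gamma>" and ?M = "medial G"
  have fin: "finite ?E" using G by (simp add: ribbon_graph_def)
  have weight: "(\<Prod>e \<in> ?E. ?wt (s e))
      = \<alpha> ^ num_choices ?M s White * \<beta> ^ num_choices ?M s Black * \<gamma> ^ num_choices ?M s Crossing" for s
  proof -
    have "(\<Prod>e \<in> ?E. ?wt (s e)) = (\<Prod>c \<in> UNIV. \<Prod>e \<in> {e \<in> ?E. s e = c}. ?wt (s e))"
    proof (rule prod.group[symmetric])
      show "finite (UNIV :: transition set)" unfolding UNIV_transition by simp
    qed (simp_all add: fin)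
    also have "\<dots> = (\<Prod>c \<in> UNIV. ?wt c ^ num_choices ?M s c)"
      by (intro prod.cong refl) (simp add: num_choices_def medial_def)
    finally show ?thesis by (simp add: UNIV_transition mult.assoc)
  qed
  have curves: "num_curves ?M s
      = num_classes (corners ?E) (state_joins ?E s \<union> arcs G) + isolated G" for s
  proof -
    have "(\<Union>e \<in> nodes ?M. halves ?M e) = corners ?E"
      by (auto simp: medial_def corners_def)
    moreover have "links ?M \<union> (\<Union>e \<in> nodes ?M. joins ?M e (s e)) = state_joins ?E s \<union> arcs G"
      unfolding joins_medial state_joins_def by (auto simp: medial_def)
    ultimately show ?thesis
      by (simp add: num_curves_def medial_def)
  qed
  show ?thesis
    unfolding Omega_of_ribbon[OF G] transition_poly_def prod.case weight curves
    by (simp add: graph_states_def medial_def)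
qed

theorem proposition3p5:
  fixes G :: "'e ribbon"
    and x y sqrt_x sqrt_y :: "'a::field"
    and l \<alpha> \<beta> \<gamma> t :: "'b::comm_ring_1"
  assumes "ribbon_graph G"
    and "sqrt_x \<noteq> 0" and "sqrt_y \<noteq> 0"
    and "x = sqrt_x ^ 2" and "y = sqrt_y ^ 2"
  shows
    "(plane G \<longrightarrow>
        Omega (of_ribbon G) 0 (sqrt_y / sqrt_x) 1 0 (sqrt_x * sqrt_y)
          = x ^ num_components G * (sqrt_y / sqrt_x) ^ num_vertices G * tutte G (x + 1) (y + 1)) \<and>
     Omega (of_ribbon G) 0 (sqrt_y / sqrt_x) 1 0 (sqrt_x * sqrt_y)
       = x ^ num_components G * (sqrt_y / sqrt_x) ^ num_vertices G
         * bollobas_riordan G (x + 1) y (1 / (sqrt_x * sqrt_y)) \<and>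
     Omega (of_ribbon G) 0 1 0 (- 1) l = penrose G l \<and>
     Omega (of_ribbon G) 0 \<alpha> \<beta> \<gamma> t = transition_poly G (\<alpha>, \<beta>, \<gamma>) t"
  unfolding assms(4,5)
proof (intro conjI impI)
  let ?xy = "1 / (sqrt_x * sqrt_y)"
  show R: "Omega (of_ribbon G) 0 (sqrt_y / sqrt_x) 1 0 (sqrt_x * sqrt_y)
      = (sqrt_x ^ 2) ^ num_components G * (sqrt_y / sqrt_x) ^ num_vertices G
        * bollobas_riordan G (sqrt_x ^ 2 + 1) (sqrt_y ^ 2) ?xy"
    by (rule Omega_eq_bollobas_riordan[OF assms(1-3)])
  show "Omega (of_ribbon G) 0 (sqrt_y / sqrt_x) 1 0 (sqrt_x * sqrt_y)
      = (sqrt_x ^ 2) ^ num_components G * (sqrt_y / sqrt_x) ^ num_vertices G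
        * tutte G (sqrt_x ^ 2 + 1) (sqrt_y ^ 2 + 1)" if "plane G"
    unfolding R bollobas_riordan_plane[OF assms(1) that] ..
  show "Omega (of_ribbon G) 0 1 0 (- 1) l = penrose G l"
    by (rule Omega_eq_penrose[OF assms(1)])
  show "Omega (of_ribbon G) 0 \<alpha> \<beta> \<gamma> t = transition_poly G (\<alpha>, \<beta>, \<gamma>) t"
    by (rule Omega_eq_transition_poly[OF assms(1)])
qed

end
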